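(* For every positive integer $k$ there exist constants $c_k,C_k>0$ such that for all sufficiently large $n$, \[ D(n,k)\geq c_k\,\frac{n^{2\lfloor k/3\rfloor}}{e^{C_k\sqrt{\log n}}}. \]
   Context: All graphs are finite, simple and undirected. For a graph $G$ and an integer $k\geq 1$, the $k$-configuration graph $\mathcal{R}_k(G)$ (token jumping model) is the graph whose vertices are the independent sets of $G$ of size exactly $k$, where two such independent sets $I,J$ are adjacent if and only if $|I\cap J|=k-1$. $D(n,k)$ denotes the maximum, over all graphs $G$ on $n$ vertices, of the largest diameter of a connected component of $\mathcal{R}_k(G)$. *)

theory Defs
  imports "Graph_Theory.Graph_Theory"
begin

text \<open>
  Finite simple undirected graphs are symmetric, loop-free finite digraphs whose arcs are pairs
  of vertices (locale \<open>pair_graph\<close>): an undirected edge is a pair of opposite arcs.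
\<close>

definition independent_set :: "'a pair_pre_digraph \<Rightarrow> 'a set \<Rightarrow> bool" where
  "independent_set G I \<longleftrightarrow> I \<subseteq> pverts G \<and> (\<forall>u\<in>I. \<forall>v\<in>I. (u, v) \<notin> parcs G)"

definition config_graph :: "nat \<Rightarrow> 'a pair_pre_digraph \<Rightarrow> 'a set pair_pre_digraph" where
  "config_graph k G =
     \<lparr> pverts = {I. independent_set G I \<and> card I = k},
       parcs = {(I, J). independent_set G I \<and> card I = k \<and> independent_set G J \<and> card J = k \<and>
                        card (I \<inter> J) + 1 = k} \<rparr>"

definition connected_component_of :: "('a, 'b) pre_digraph \<Rightarrow> ('a, 'b) pre_digraph \<Rightarrow> bool" where
  "connected_component_of G H \<longleftrightarrow> pre_digraph.max_subgraph G Digraph_Component.connected H"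

definition graph_distance :: "('a, 'b) pre_digraph \<Rightarrow> 'a \<Rightarrow> 'a \<Rightarrow> ereal" where
  "graph_distance G u v = wf_digraph.\<mu> G (\<lambda>_. 1) u v"

definition graph_diameter :: "('a, 'b) pre_digraph \<Rightarrow> ereal" where
  "graph_diameter G = (SUP u\<in>verts G. SUP v\<in>verts G. graph_distance G u v)"

text \<open>
  Every graph on \<open>n\<close> vertices is isomorphic to one with natural numbers as vertices.  Graphs whose
  configuration graph is empty have no component and contribute nothing; the suprema are finite and
  attained (lemmas \<open>max_config_diameter_le\<close> and \<open>max_config_diameter_attained\<close> below).
\<close>

definition max_config_diameter :: "nat \<Rightarrow> nat \<Rightarrow> ereal" where
  "max_config_diameter n k =
     (SUP G\<in>{G :: nat pair_pre_digraph. pair_graph G \<and> card (pverts G) = n}.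
        SUP H\<in>{H. connected_component_of (with_proj (config_graph k G)) H}. graph_diameter H)"


lemma pair_graph_config_graph:
  assumes "pair_graph G"
  shows "pair_graph (config_graph k G)"
proof -
  interpret pair_graph G by fact
  have fin: "finite {I. independent_set G I \<and> card I = k}"
    by (rule finite_subset[of _ "Pow (pverts G)"]) (auto simp: independent_set_def)
  have ne: "I \<noteq> J" if "card (I \<inter> J) + 1 = k" "card I = k" for I J :: "'a set"
    using that by auto
  show ?thesis
  proof
    show "finite (pverts (config_graph k G))" using fin by (simp add: config_graph_def)
    show "finite (parcs (config_graph k G))"
      by (rule finite_subset[OF _ finite_cartesian_product[OF fin fin]])
        (auto simp: config_graph_def)
    show "symmetric (with_proj (config_graph k G))"
      by (auto simp: config_graph_def symmetric_def arcs_ends_def arc_to_ends_def Int_commute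
          intro!: symI)
  next
    fix e
    assume "e \<in> parcs (config_graph k G)"
    then obtain I J where IJ: "e = (I, J)" "I \<in> pverts (config_graph k G)"
      "J \<in> pverts (config_graph k G)" "card (I \<inter> J) + 1 = k" "card I = k"
      by (cases e) (simp add: config_graph_def)
    then show "fst e \<in> pverts (config_graph k G)" "snd e \<in> pverts (config_graph k G)" by simp_all
    show "fst e \<noteq> snd e" using IJ(1) ne[OF IJ(4,5)] by simp
  qed
qed

lemma card_config_graph_le:
  assumes "pair_graph G"
  shows "card (pverts (config_graph k G)) \<le> card (pverts G) choose k"
proof -
  interpret pair_graph G by fact
  have "card (pverts (config_graph k G)) \<le> card {I. I \<subseteq> pverts G \<and> card I = k}"
    by (rule card_mono) (auto simp: config_graph_def independent_set_def)
  then show ?thesis by (simp add: n_subsets)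
qed

lemma connected_component_of_iff_sccs:
  assumes "graph R"
  shows "connected_component_of R H \<longleftrightarrow> H \<in> pre_digraph.sccs R"
proof -
  interpret graph R by fact
  have conn_iff: "Digraph_Component.connected (R \<restriction> verts K) \<longleftrightarrow> strongly_connected (R \<restriction> verts K)"
    and sub: "subgraph K (R \<restriction> verts K)" "subgraph (R \<restriction> verts K) R"
    if "subgraph K R" for K
  proof -
    have wfK: "wf_digraph K" and vs: "verts K \<subseteq> verts R" using that by (auto simp: subgraph_def)
    have ind: "induced_subgraph (R \<restriction> verts K) R" using vs by (rule induced_induce)
    then show subR: "subgraph (R \<restriction> verts K) R" by (simp add: induced_subgraph_def)
    then have wf': "wf_digraph (R \<restriction> verts K)" by (auto simp: subgraph_def)
    show "subgraph K (R \<restriction> verts K)"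
      using that wf' by (auto simp: subgraph_def compatible_def wf_digraph_def)
    have symm: "symmetric (R \<restriction> verts K)"
      by (rule induced_graph_imp_symmetric[OF sym_arcs ind])
    show "Digraph_Component.connected (R \<restriction> verts K) \<longleftrightarrow> strongly_connected (R \<restriction> verts K)"
    proof
      assume "Digraph_Component.connected (R \<restriction> verts K)"
      then show "strongly_connected (R \<restriction> verts K)"
        using wf_digraph.symmetric_connected_imp_strongly_connected[OF wf' symm] by blast
    next
      assume "strongly_connected (R \<restriction> verts K)"
      then show "Digraph_Component.connected (R \<restriction> verts K)"
        using wf_digraph.reachable_mk_symmetricI[OF wf']
        unfolding Digraph_Component.connected_def strongly_connected_def by simp
    qed
  qed
  have mono: "P (R \<restriction> verts K)"
    if "subgraph K R" "P K" "P = Digraph_Component.connected \<or> P = strongly_connected" for K P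
  proof -
    have "spanning K (R \<restriction> verts K)" using sub(1)[OF that(1)] by (simp add: spanning_def)
    moreover have "wf_digraph (R \<restriction> verts K)" using sub(2)[OF that(1)] by (simp add: subgraph_def)
    ultimately show ?thesis
      using that(2,3) wf_digraph.connected_spanning_imp_connected[of "R \<restriction> verts K" K]
        wf_digraph.strongly_connected_spanning_imp_strongly_connected[of "R \<restriction> verts K" K]
      by (elim disjE) simp_all
  qed
  have imp: "max_subgraph Q H"
    if P: "max_subgraph P H"
      and PQ: "P = Digraph_Component.connected \<and> Q = strongly_connected
             \<or> P = strongly_connected \<and> Q = Digraph_Component.connected" for P Q
  proof -
    have iff: "P (R \<restriction> verts K) \<longleftrightarrow> Q (R \<restriction> verts K)" if "subgraph K R" for K
      using conn_iff[OF that] PQ by auto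
    have H: "subgraph H R" "P H" using P by (auto simp: max_subgraph_def)
    have max: "H' = H" if "subgraph H H'" "subgraph H' R" "P H'" for H'
      using P that by (auto simp: max_subgraph_def)
    have "P (R \<restriction> verts H)" using mono[of H P, OF H] PQ by metis
    then have eq: "R \<restriction> verts H = H" using max sub[OF H(1)] by blast
    then have QH: "Q H" using iff[OF H(1)] H(2) by simp
    have "H' = H" if H': "subgraph H H'" "subgraph H' R" "Q H'" for H'
    proof -
      have "P (R \<restriction> verts H')" using mono[of H' Q, OF H'(2,3)] PQ iff[OF H'(2)] by metis
      moreover have "subgraph H (R \<restriction> verts H')"
        using subgraph_trans[OF H'(1)] sub(1)[OF H'(2)] by blast
      ultimately have "R \<restriction> verts H' = H" using max sub(2)[OF H'(2)] by blast
      then have "subgraph H' H" using sub(1)[OF H'(2)] by simp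
      then show ?thesis
        using H'(1) by (intro pre_digraph.equality) (auto simp: subgraph_def compatible_def)
    qed
    then have "\<forall>H'. H' \<noteq> H \<and> subgraph H H' \<longrightarrow> \<not> (subgraph H' R \<and> Q H')" by auto
    with H(1) QH show ?thesis unfolding max_subgraph_def by (intro conjI)
  qed
  have "max_subgraph Digraph_Component.connected H \<longleftrightarrow> max_subgraph strongly_connected H"
    by (rule iffI; erule imp) simp_all
  then show ?thesis by (simp add: connected_component_of_def sccs_altdef2)
qed

lemma connected_component_of_strongly_connected:
  assumes "graph R" "connected_component_of R H"
  shows "fin_digraph H" "strongly_connected H" "card (verts H) \<le> card (verts R)"
proof -
  interpret graph R by fact
  have "H \<in> sccs" using connected_component_of_iff_sccs assms by blast
  then have H: "induced_subgraph H R" "strongly_connected H" by auto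
  then show "strongly_connected H" by simp
  have "wf_digraph H" "verts H \<subseteq> verts R" "arcs H \<subseteq> arcs R"
    using H by (auto simp: induced_subgraph_def subgraph_def)
  then show "fin_digraph H" "card (verts H) \<le> card (verts R)"
    using finite_subset[OF _ finite_verts] finite_subset[OF _ finite_arcs]
    by (simp_all add: fin_digraph_def fin_digraph_axioms_def card_mono)
qed

lemma graph_distance_nat:
  assumes "fin_digraph H" "strongly_connected H" "u \<in> verts H" "v \<in> verts H"
  shows "\<exists>d<card (verts H). graph_distance H u v = ereal (real d)"
proof -
  interpret fin_digraph H by fact
  have "u \<rightarrow>\<^sup>*\<^bsub>H\<^esub> v" using assms by auto
  from min_cost_awalk[OF this, of "\<lambda>_. 1"] obtain p
    where p: "apath u p v" "\<mu> (\<lambda>_. 1) u v = awalk_cost (\<lambda>_. 1) p" by auto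
  have "awalk_cost (\<lambda>_. 1) p = real (length p)" by (induction p) auto
  with p show ?thesis using length_apath_less[OF p(1)] unfolding graph_distance_def by auto
qed

lemma ereal_SUP_bounded_nats:
  assumes "A \<noteq> {}" "\<And>x. x \<in> A \<Longrightarrow> \<exists>d\<le>N. f x = ereal (real d)"
  shows "(SUP x\<in>A. f x) \<in> f ` A"
proof -
  have "f ` A \<subseteq> (\<lambda>d. ereal (real d)) ` {..N}" using assms(2) by fastforce
  then have "finite (f ` A)" by (rule finite_subset) simp
  then show ?thesis using assms(1) Max_in[of "f ` A"] by (simp add: Max_Sup)
qed

lemma graph_diameter_component:
  assumes "graph R" "connected_component_of R H"
  shows "\<exists>d\<le>card (verts R). graph_diameter H = ereal (real d)"
proof -
  note H = connected_component_of_strongly_connected[OF assms]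
  let ?N = "card (verts R)"
  have ne: "verts H \<noteq> {}" using H(2) by (auto simp: strongly_connected_def)
  have 1: "\<exists>d\<le>?N. graph_distance H u v = ereal (real d)" if "u \<in> verts H" "v \<in> verts H" for u v
    using graph_distance_nat[OF H(1,2) that] H(3) by (meson less_imp_le order_trans)
  have 2: "\<exists>d\<le>?N. (SUP v\<in>verts H. graph_distance H u v) = ereal (real d)"
    if "u \<in> verts H" for u
    using ereal_SUP_bounded_nats[OF ne, of ?N "graph_distance H u"] 1[OF that] by fastforce
  show ?thesis
    using ereal_SUP_bounded_nats[OF ne, of ?N "\<lambda>u. SUP v\<in>verts H. graph_distance H u v"] 2
    unfolding graph_diameter_def by fastforce
qed

lemma max_config_diameter_le: "max_config_diameter n k \<le> ereal (real (n choose k))"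
  unfolding max_config_diameter_def
proof (intro SUP_least)
  fix G :: "nat pair_pre_digraph" and H
  assume "G \<in> {G. pair_graph G \<and> card (pverts G) = n}"
    and H: "H \<in> {H. connected_component_of (with_proj (config_graph k G)) H}"
  then have G: "pair_graph G" "card (pverts G) = n" by auto
  interpret R: pair_graph "config_graph k G" by (rule pair_graph_config_graph[OF G(1)])
  have "graph (with_proj (config_graph k G))" by unfold_locales
  from graph_diameter_component[OF this] H card_config_graph_le[OF G(1), of k] G(2)
  show "graph_diameter H \<le> ereal (real (n choose k))" by fastforce
qed

lemma max_config_diameter_attained:
  assumes "k \<le> n"
  shows "\<exists>(G :: nat pair_pre_digraph) H. pair_graph G \<and> card (pverts G) = n \<and>
           connected_component_of (with_proj (config_graph k G)) H \<and>
           max_config_diameter n k = graph_diameter H"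
proof -
  define S where "S = {(G :: nat pair_pre_digraph, H). pair_graph G \<and> card (pverts G) = n \<and>
    connected_component_of (with_proj (config_graph k G)) H}"
  have eq: "max_config_diameter n k = (SUP x\<in>S. graph_diameter (snd x))"
  proof (rule antisym)
    show "max_config_diameter n k \<le> (SUP x\<in>S. graph_diameter (snd x))"
      unfolding max_config_diameter_def
    proof (intro SUP_least)
      fix G H
      assume "G \<in> {G :: nat pair_pre_digraph. pair_graph G \<and> card (pverts G) = n}"
        and "H \<in> {H. connected_component_of (with_proj (config_graph k G)) H}"
      then have "(G, H) \<in> S" by (auto simp: S_def)
      then show "graph_diameter H \<le> (SUP x\<in>S. graph_diameter (snd x))"
        by (rule SUP_upper2) simp
    qed
    show "(SUP x\<in>S. graph_diameter (snd x)) \<le> max_config_diameter n k"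
      unfolding max_config_diameter_def
      by (rule SUP_least) (auto simp: S_def intro!: SUP_upper2)
  qed
  have bd: "\<exists>d\<le>n choose k. graph_diameter (snd x) = ereal (real d)" if "x \<in> S" for x
  proof -
    from that obtain G H where x: "x = (G, H)" and G: "pair_graph G" "card (pverts G) = n"
      and H: "connected_component_of (with_proj (config_graph k G)) H" by (auto simp: S_def)
    interpret R: pair_graph "config_graph k G" by (rule pair_graph_config_graph[OF G(1)])
    have "graph (with_proj (config_graph k G))" by unfold_locales
    from graph_diameter_component[OF this H] card_config_graph_le[OF G(1), of k] G(2)
    show ?thesis by (fastforce simp: x)
  qed
  have "S \<noteq> {}"
  proof -
    define G :: "nat pair_pre_digraph" where "G = \<lparr>pverts = {..<n}, parcs = {}\<rparr>"
    have G: "pair_graph G"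
      by unfold_locales (auto simp: G_def symmetric_def arcs_ends_def sym_def)
    interpret R: pair_graph "config_graph k G" by (rule pair_graph_config_graph[OF G])
    let ?R = "with_proj (config_graph k G)"
    have "{..<k} \<in> verts ?R"
      using assms by (auto simp: config_graph_def independent_set_def G_def)
    then obtain H where "H \<in> pre_digraph.sccs ?R"
      using R.induce_reachable_is_in_sccs by fastforce
    moreover have "graph ?R" by unfold_locales
    ultimately have "connected_component_of ?R H"
      by (simp add: connected_component_of_iff_sccs)
    moreover have "card (pverts G) = n" by (simp add: G_def)
    ultimately have "(G, H) \<in> S" using G by (simp add: S_def)
    then show ?thesis by blast
  qed
  then have "(SUP x\<in>S. graph_diameter (snd x)) \<in> (\<lambda>x. graph_diameter (snd x)) ` S"
    by (rule ereal_SUP_bounded_nats) (rule bd)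
  then obtain x where "x \<in> S" "max_config_diameter n k = graph_diameter (snd x)"
    unfolding eq by blast
  then show ?thesis by (cases x) (auto simp: S_def)
qed

end

theory Submission
  imports Defs "HOL-Library.FuncSet"
begin

text \<open>
  Passing to complements, independent sets become cliques.  Ruzsa--Szemeredi graphs, built from
  Behrend's sets without three-term progressions, yield a graph on \<open>N\<close> vertices in which a walk of
  length \<open>N\<^sup>2 / exp (O (sqrt (log N)))\<close> is essentially the only way between two triangles.  Such
  graphs are stacked like the digits of a counter: some vertices of a level are joined, on each
  lower level, only to the initial or only to the final triangle, so that the upper level can make
  a step only after the lower ones have run through their whole walk.  Each level uses three tokens
  and multiplies the distance by the length of its walk.
\<close>

section \<open>Lower bounds from potentials\<close>

text \<open>Distances are bounded through an integer potential that changes by at most one per jump,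
  so no shortest path is ever determined and the reachability proofs may use wasteful walks. The
  levels stay separate by counting: no level contains a four-clique, so a clique of
  \<open>3 * m\<close> vertices on \<open>m\<close> levels has exactly three on each, and no jump
  moves a token to another level.

  The obstacle is that a vertex of the triangle graph lies in many rows, hence is met at many times
  of the walk, while its restriction on the lower levels is fixed once. Therefore a row has
  \<open>M = 4 * h + 1\<close> blocks and each turn one more: with alternating directions,
  \<open>U x\<close> with \<open>x - 1\<close> odd is met at the same odd time modulo 4 in every
  row. Residue 1 demands the final and residue 3 the initial clique below, which forces one full
  traversal per two blocks.

  The loss in the exponent is Behrend's: \<open>d\<close> digits in base \<open>2 ^ d\<close> give
  density about \<open>2 ^ (- 4 * d)\<close> among \<open>2 ^ d\<^sup>2\<close> numbers, and
  \<open>d\<close> has the order of \<open>sqrt (log n)\<close>. The tokens counted by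
  \<open>k mod 3\<close> are frozen on extra vertices.\<close>

lemma potential_le_max_config_diameter:
  fixes G :: "nat pair_pre_digraph" and pot :: "nat set \<Rightarrow> int"
  assumes G: "pair_graph G"
    and S: "S \<in> pverts (config_graph k G)"
    and ST: "(S, T) \<in> (parcs (config_graph k G))\<^sup>*"
    and pot: "\<And>I J. (I, J) \<in> parcs (config_graph k G) \<Longrightarrow> pot J \<le> pot I + 1"
  shows "ereal (pot T - pot S) \<le> max_config_diameter (card (pverts G)) k"
proof -
  interpret R: pair_graph "config_graph k G" by (rule pair_graph_config_graph[OF G])
  let ?R = "with_proj (config_graph k G)"
  let ?H = "?R \<restriction> {v. S \<rightarrow>\<^sup>*\<^bsub>?R\<^esub> v}"
  have "S \<in> verts ?R" using S by simp
  then have scc: "?H \<in> pre_digraph.sccs ?R" using R.induce_reachable_is_in_sccs by fastforce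
  have "graph ?R" by unfold_locales
  then have comp: "connected_component_of ?R ?H"
    using scc by (simp add: connected_component_of_iff_sccs)
  have "S \<rightarrow>\<^sup>*\<^bsub>?R\<^esub> T"
    using ST
  proof (induction rule: rtrancl_induct)
    case base
    show ?case using S by (simp add: R.reachable_refl)
  next
    case (step I J)
    then have "I \<rightarrow>\<^bsub>?R\<^esub> J" by (simp add: arcs_ends_def arc_to_ends_def)
    with step.IH show ?case by (rule wf_digraph.reachable_adj_trans[OF R.wf_digraph])
  qed
  then have ST': "S \<in> verts ?H" "T \<in> verts ?H" using S by (auto simp: R.reachable_refl)
  have "subgraph ?H ?R"
    using pre_digraph.in_sccs_imp_induced[OF scc] by (rule induced_imp_subgraph)
  then interpret H: wf_digraph ?H by (auto simp: subgraph_def)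
  have walk: "pot J \<le> pot I + int (length p)" if "H.awalk I p J" for I p J
    using that
  proof (induction p arbitrary: I)
    case Nil
    then show ?case by (simp add: H.awalk_Nil_iff)
  next
    case (Cons e p)
    then have e: "e \<in> arcs ?H" "I = tail ?H e" and "H.awalk (head ?H e) p J"
      by (simp_all add: H.awalk_Cons_iff)
    then have "pot J \<le> pot (head ?H e) + int (length p)" using Cons.IH by blast
    moreover have "e \<in> parcs (config_graph k G)" using e(1) by (auto simp: induce_subgraph_def)
    then have "pot (head ?H e) \<le> pot (tail ?H e) + 1"
      using pot[of "fst e" "snd e"] by (simp add: induce_subgraph_def)
    ultimately show ?case using e(2) by simp
  qed
  have cost: "H.awalk_cost (\<lambda>_. 1) p = real (length p)" for p
    by (induction p) auto
  have "ereal (pot T - pot S) \<le> graph_distance ?H S T"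
    unfolding graph_distance_def H.\<mu>_def
  proof (rule INF_greatest)
    fix p assume "p \<in> {p. H.awalk S p T}"
    then have "pot T - pot S \<le> int (length p)" using walk[of S p T] by simp
    then have "real_of_int (pot T - pot S) \<le> real (length p)" by linarith
    then show "ereal (pot T - pot S) \<le> ereal (H.awalk_cost (\<lambda>_. 1) p)"
      by (simp add: cost)
  qed
  also have "\<dots> \<le> graph_diameter ?H"
    unfolding graph_diameter_def using ST' by (meson SUP_upper2 order_refl)
  also have "\<dots> \<le> max_config_diameter (card (pverts G)) k"
    unfolding max_config_diameter_def
    by (rule SUP_upper2[where i = G], use G in simp) (use comp in \<open>auto intro: SUP_upper\<close>)
  finally show ?thesis .
qed

section \<open>Configurations as cliques of the complement\<close>

definition cliques :: "'a set \<Rightarrow> ('a \<Rightarrow> 'a \<Rightarrow> bool) \<Rightarrow> nat \<Rightarrow> 'a set set" where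
  "cliques X E k =
     {C. C \<subseteq> X \<and> finite C \<and> card C = k \<and> (\<forall>u\<in>C. \<forall>v\<in>C. u \<noteq> v \<longrightarrow> E u v)}"

definition jumps :: "'a set set \<Rightarrow> ('a set \<times> 'a set) set" where
  "jumps K = {(I, J). I \<in> K \<and> J \<in> K \<and> card (I \<inter> J) + 1 = card I}"

lemma cliques_subset:
  assumes "C \<in> cliques X E k" "D \<subseteq> C"
  shows "D \<in> cliques X E (card D)"
  using assms by (auto simp: cliques_def intro: finite_subset)

lemma cliques_card_le:
  assumes "cliques X E (Suc k) = {}" "C \<in> cliques X E l"
  shows "l \<le> k"
proof (rule ccontr)
  assume "\<not> l \<le> k"
  then have "Suc k \<le> card C" using assms(2) by (simp add: cliques_def)
  then obtain D where "D \<subseteq> C" "card D = Suc k" by (meson obtain_subset_with_card_n)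
  then show False using cliques_subset[OF assms(2), of D] assms(1) by simp
qed

lemma jumps_sym: "(I, J) \<in> jumps (cliques Y F k) \<Longrightarrow> (J, I) \<in> jumps (cliques Y F k)"
  by (auto simp: jumps_def cliques_def Int_commute)

lemma jumps_rtrancl_sym:
  "(I, J) \<in> (jumps (cliques Y F k))\<^sup>* \<Longrightarrow> (J, I) \<in> (jumps (cliques Y F k))\<^sup>*"
  by (rule symD[OF sym_rtrancl]) (auto intro: symI jumps_sym)

text \<open>\<open>G\<close> is the complement of \<open>A\<close>, in which the \<open>j\<close>
  vertices of \<open>B\<close> are joined to each other and to the copy of \<open>X\<close>, and all
  further vertices to nothing. As \<open>X\<close> has no clique larger than \<open>k\<close>, a
  clique of size \<open>k + j\<close> contains all of \<open>B\<close>, so \<open>j\<close> tokens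
  are frozen. A filler vertex could only be a configuration by itself; either
  \<open>2 \<le> k + j\<close> rules this out, or \<open>card X + j = n\<close> and there are no
  fillers.\<close>

lemma clique_potential_le_max_config_diameter:
  fixes pot :: "'a set \<Rightarrow> int"
  assumes X: "finite X" and sym: "\<And>u v. E u v \<Longrightarrow> E v u"
    and no: "cliques X E (Suc k) = {}"
    and S: "S \<in> cliques X E k" and ST: "(S, T) \<in> (jumps (cliques X E k))\<^sup>*"
    and pot: "\<And>I J. (I, J) \<in> jumps (cliques X E k) \<Longrightarrow> pot J \<le> pot I + 1"
    and n: "card X + j \<le> n" "2 \<le> k + j \<or> card X + j = n"
  shows "ereal (pot T - pot S) \<le> max_config_diameter n (k + j)"
proof -
  let ?c = "card X"
  obtain f where f: "bij_betw f X {..<?c}" using X by (metis ex_bij_betw_finite_nat atLeast0LessThan)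
  define f' where "f' = the_inv_into X f"
  have inj: "inj_on f X" and img: "f ` X = {..<?c}" using f by (auto simp: bij_betw_def)
  have f'f: "f' (f x) = x" if "x \<in> X" for x using that inj by (simp add: f'_def the_inv_into_f_f)
  have fX: "f x < ?c" if "x \<in> X" for x using img that by blast
  have f'X: "f' v \<in> X" "f (f' v) = v" if "v < ?c" for v
    using that f by (auto simp: f'_def f_the_inv_into_f_bij_betw bij_betw_def
        intro!: the_inv_into_into)
  define B where "B = {?c..<?c + j}"
  define A where "A u v \<longleftrightarrow> u < ?c \<and> v < ?c \<and> E (f' u) (f' v) \<or> u \<in> B \<and> v < ?c + j \<or> v \<in> B \<and> u < ?c + j"
    for u v
  define G :: "nat pair_pre_digraph" where
    "G = \<lparr>pverts = {..<n}, parcs = {(u, v). u < n \<and> v < n \<and> u \<noteq> v \<and> \<not> A u v}\<rparr>"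
  have symA: "A u v \<Longrightarrow> A v u" for u v using sym by (auto simp: A_def)
  have G: "pair_graph G"
  proof
    show "finite (pverts G)" by (simp add: G_def)
    show "finite (parcs G)"
      by (rule finite_subset[of _ "{..<n} \<times> {..<n}"]) (auto simp: G_def)
    show "symmetric (with_proj G)" using symA
      by (auto simp: G_def symmetric_def arcs_ends_def arc_to_ends_def intro!: symI)
  qed (auto simp: G_def)
  have ind: "independent_set G I \<longleftrightarrow> I \<subseteq> {..<n} \<and> (\<forall>u\<in>I. \<forall>v\<in>I. u \<noteq> v \<longrightarrow> A u v)" for I
    by (auto simp: independent_set_def G_def)
  define F where "F C = f ` C \<union> B" for C
  have fB: "f ` C \<inter> B = {}" if "C \<subseteq> X" for C using that fX by (force simp: B_def)
  have cardF: "card (F C) = card C + j" if "C \<subseteq> X" for C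
    using fB[OF that] that finite_subset[OF that X] inj_on_subset[OF inj that]
    by (simp add: F_def card_Un_disjoint card_image B_def)
  have FI: "independent_set G (F C)" if C: "C \<in> cliques X E l" for C l
  proof -
    have CX: "C \<subseteq> X" using C by (simp add: cliques_def)
    have "F C \<subseteq> {..<?c + j}" using fX CX by (force simp: F_def B_def)
    moreover have "A u v" if "u \<in> F C" "v \<in> F C" "u \<noteq> v" for u v
    proof (cases "u \<in> B \<or> v \<in> B")
      case True
      then show ?thesis using calculation that by (auto simp: A_def)
    next
      case False
      then obtain x y where xy: "x \<in> C" "y \<in> C" "u = f x" "v = f y"
        using \<open>u \<in> F C\<close> \<open>v \<in> F C\<close> by (auto simp: F_def)
      then have "x \<noteq> y" using \<open>u \<noteq> v\<close> by auto
      then have "E x y" using C xy by (auto simp: cliques_def)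
      moreover have "f x < ?c" "f y < ?c" "f' (f x) = x" "f' (f y) = y"
        using xy CX fX f'f by auto
      ultimately show ?thesis by (simp add: A_def xy)
    qed
    ultimately show ?thesis using n(1) by (force simp: ind)
  qed
  have IF: "\<exists>C\<in>cliques X E k. I = F C" if I: "independent_set G I" "card I = k + j" for I
  proof -
    have fin: "finite I" using I(1) finite_subset by (auto simp: ind)
    have lt: "u < ?c + j" if u: "u \<in> I" for u
    proof (cases "2 \<le> k + j")
      case True
      then have "\<not> I \<subseteq> {u}" using I(2) card_mono[of "{u}" I] by auto
      then obtain v where "v \<in> I" "v \<noteq> u" by blast
      then have "A u v" using I(1) u by (auto simp: ind)
      then show ?thesis by (auto simp: A_def B_def)
    next
      case False
      then show ?thesis using n(2) I(1) u by (auto simp: ind)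
    qed
    define C where "C = f' ` (I - B)"
    have IB: "u < ?c" if "u \<in> I - B" for u using lt[of u] that by (auto simp: B_def)
    have "inj_on f' (I - B)" by (rule inj_on_inverseI[where g = f]) (use IB f'X in auto)
    then have cC: "card C = card (I - B)" by (simp add: C_def card_image)
    have C: "C \<in> cliques X E (card C)"
    proof -
      have "E (f' u) (f' v)" if "u \<in> I - B" "v \<in> I - B" "u \<noteq> v" for u v
        using I(1) that by (auto simp: ind A_def)
      then show ?thesis using fin IB f'X by (auto simp: C_def cliques_def)
    qed
    have fC: "f ` C = I - B" using IB f'X by (force simp: C_def image_image)
    \<comment> \<open>At most \<open>k\<close> elements lie outside \<open>B\<close> and at most
      \<open>j\<close> inside, so the total \<open>k + j\<close> makes both bounds tight.\<close>
    have "card C \<le> k" by (rule cliques_card_le[OF no C])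
    moreover have "card I = card (I - B) + card (I \<inter> B)"
      using fin by (metis Diff_Int_distrib2 Diff_disjoint Int_Diff Un_Diff_Int add.commute card_Un_disjoint finite_Diff finite_Int inf_commute)
    moreover have cB: "card (I \<inter> B) \<le> card B" "card B = j"
      by (rule card_mono) (simp_all add: B_def)
    ultimately have "card C = k" "card (I \<inter> B) = card B" using I(2) cC by auto
    then have "B \<subseteq> I" using card_subset_eq[of B "I \<inter> B"] by (auto simp: B_def)
    then have "I = F C" using fC by (auto simp: F_def)
    with C \<open>card C = k\<close> show ?thesis by auto
  qed
  have jump: "(F C, F D) \<in> parcs (config_graph (k + j) G) \<longleftrightarrow> (C, D) \<in> jumps (cliques X E k)"
    if C: "C \<in> cliques X E k" and D: "D \<in> cliques X E k" for C D
  proof -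
    have CD: "C \<subseteq> X" "D \<subseteq> X" "card C = k" "card D = k" using C D by (auto simp: cliques_def)
    have "F C \<inter> F D = F (C \<inter> D)"
      using inj_on_image_Int[OF inj CD(1,2)] fB[OF CD(1)] fB[OF CD(2)] by (auto simp: F_def)
    moreover have "card (F (C \<inter> D)) = card (C \<inter> D) + j" using CD by (intro cardF) auto
    ultimately show ?thesis
      using FI[OF C] FI[OF D] cardF[OF CD(1)] cardF[OF CD(2)] CD C D
      by (auto simp: config_graph_def jumps_def)
  qed
  define F' where "F' I = f' ` (I - B)" for I
  have F'F: "F' (F C) = C" if "C \<in> cliques X E k" for C
  proof -
    have "C \<subseteq> X" using that by (simp add: cliques_def)
    then have "F C - B = f ` C" using fB by (auto simp: F_def)
    moreover have "f' ` f ` C = C"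
      unfolding image_image using \<open>C \<subseteq> X\<close> f'f by (simp add: subset_iff cong: image_cong_simp)
    ultimately show ?thesis by (simp add: F'_def)
  qed
  have "(F S, F T) \<in> (parcs (config_graph (k + j) G))\<^sup>*" using ST
  proof (induction rule: rtrancl_induct)
    case (step C D)
    then show ?case using jump[of C D] by (auto simp: jumps_def intro: rtrancl_into_rtrancl)
  qed simp
  moreover have "T \<in> cliques X E k" using ST S by (cases rule: rtranclE) (auto simp: jumps_def)
  moreover have "F S \<in> pverts (config_graph (k + j) G)"
    using FI[OF S] cardF[of S] S by (auto simp: config_graph_def cliques_def)
  moreover have "pot (F' J) \<le> pot (F' I) + 1" if IJ: "(I, J) \<in> parcs (config_graph (k + j) G)" for I J
  proof -
    obtain C D where "C \<in> cliques X E k" "I = F C" "D \<in> cliques X E k" "J = F D"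
      using IJ IF[of I] IF[of J] by (auto simp: config_graph_def)
    then show ?thesis using IJ jump pot F'F by auto
  qed
  ultimately have "ereal (pot (F' (F T)) - pot (F' (F S))) \<le> max_config_diameter (card (pverts G)) (k + j)"
    using potential_le_max_config_diameter[OF G, where pot = "\<lambda>I. pot (F' I)"] by blast
  then show ?thesis using F'F[OF S] F'F[OF \<open>T \<in> _\<close>] by (simp add: G_def)
qed

section \<open>Products of gadgets\<close>

text \<open>
  The triangles of a gadget are arranged in consecutive blocks \<open>0, \<dots>, P\<close>.  In the product with a
  second clique system, a vertex of type \<open>1\<close> (mod 4) is joined to the final clique of that system
  only, and a vertex of type \<open>3\<close> (mod 4) to its initial clique only; so entering an odd block forces
  the second system to have run through completely, alternately forwards and backwards.
\<close>

locale gadget =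
  fixes X :: "'a set" and E :: "'a \<Rightarrow> 'a \<Rightarrow> bool" and \<tau> :: "'a \<Rightarrow> nat"
    and S T :: "'a set" and blk :: "'a set \<Rightarrow> nat" and P :: nat
  assumes finite_X: "finite X"
    and sym: "E u v \<Longrightarrow> E v u"
    and no4: "cliques X E 4 = {}"
    and S: "S \<in> cliques X E 3" and ST: "(S, T) \<in> (jumps (cliques X E 3))\<^sup>*"
    and blk_S: "blk S = 0" and blk_T: "blk T = P" and P: "4 dvd P"
    and blk_jump: "(s, s') \<in> jumps (cliques X E 3) \<Longrightarrow> blk s' \<le> blk s + 1"
    and type_odd: "s \<in> cliques X E 3 \<Longrightarrow> z \<in> s \<Longrightarrow> odd (\<tau> z) \<Longrightarrow> \<tau> z mod 4 = blk s mod 4"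
    and blk_odd: "s \<in> cliques X E 3 \<Longrightarrow> odd (blk s) \<Longrightarrow> \<exists>z\<in>s. odd (\<tau> z)"
begin

abbreviation "tri \<equiv> cliques X E 3"

definition joins :: "'a \<Rightarrow> 'a \<Rightarrow> bool" where
  "joins z y \<longleftrightarrow> (\<tau> z mod 4 = 1 \<longrightarrow> y \<in> T) \<and> (\<tau> z mod 4 = 3 \<longrightarrow> y \<in> S)"

definition adj :: "nat \<times> 'a \<Rightarrow> nat \<times> 'a \<Rightarrow> bool" where
  "adj p q \<longleftrightarrow> (if fst p = fst q then E (snd p) (snd q)
     else if fst p < fst q then joins (snd q) (snd p) else joins (snd p) (snd q))"

definition states :: "nat \<Rightarrow> (nat \<times> 'a) set set" where
  "states m = cliques ({..<m} \<times> X) adj (3 * m)"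

text \<open>The demand of the top triangle on the lower levels, read off from its block;
  \<open>joins_iff_compat\<close> identifies it with the demands of its vertices.\<close>

definition compat :: "nat \<Rightarrow> 'a set \<Rightarrow> (nat \<times> 'a) set \<Rightarrow> bool" where
  "compat m s D \<longleftrightarrow> (blk s mod 4 = 1 \<longrightarrow> D = {..<m} \<times> T) \<and> (blk s mod 4 = 3 \<longrightarrow> D = {..<m} \<times> S)"

definition top_part :: "nat \<Rightarrow> (nat \<times> 'a) set \<Rightarrow> 'a set" where "top_part m C = {z. (m, z) \<in> C}"
definition low_part :: "nat \<Rightarrow> (nat \<times> 'a) set \<Rightarrow> (nat \<times> 'a) set" where "low_part m C = {p \<in> C. fst p < m}"

lemma adj_sym: "adj p q \<Longrightarrow> adj q p"
  using sym by (auto simp: adj_def split: if_splits)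

lemma T: "T \<in> tri"
  using ST S by (cases rule: rtranclE) (auto simp: jumps_def)

lemma triD: "s \<in> tri \<Longrightarrow> s \<subseteq> X" "s \<in> tri \<Longrightarrow> finite s" "s \<in> tri \<Longrightarrow> card s = 3"
  by (auto simp: cliques_def)

lemma statesD:
  "D \<in> states m \<Longrightarrow> D \<subseteq> {..<m} \<times> X" "D \<in> states m \<Longrightarrow> finite D" "D \<in> states m \<Longrightarrow> card D = 3 * m"
  by (auto simp: cliques_def states_def)

lemma top_low [simp]:
  assumes "D \<subseteq> {..<m} \<times> X"
  shows "top_part m (Pair m ` s \<union> D) = s" "low_part m (Pair m ` s \<union> D) = D"
  using assms by (auto simp: top_part_def low_part_def)

lemma top_low_decomp:
  assumes "C \<in> cliques ({..<Suc m} \<times> X) adj k"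
  shows "C = Pair m ` top_part m C \<union> low_part m C" "top_part m C \<in> cliques X E (card (top_part m C))"
    "low_part m C \<in> cliques ({..<m} \<times> X) adj (card (low_part m C))"
    "k = card (top_part m C) + card (low_part m C)"
proof -
  have C: "C \<subseteq> {..<Suc m} \<times> X" "finite C" "card C = k"
    and A: "\<And>u v. u \<in> C \<Longrightarrow> v \<in> C \<Longrightarrow> u \<noteq> v \<Longrightarrow> adj u v"
    using assms by (auto simp: cliques_def)
  show eq: "C = Pair m ` top_part m C \<union> low_part m C"
    using C(1) by (force simp: top_part_def low_part_def less_Suc_eq)
  have "finite (Pair m ` top_part m C)" using C(2) eq by (metis finite_Un)
  then have fin: "finite (top_part m C)" by (rule finite_imageD) (simp add: inj_on_def)
  have "E u v" if "u \<in> top_part m C" "v \<in> top_part m C" "u \<noteq> v" for u v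
    using A[of "(m, u)" "(m, v)"] that by (simp add: top_part_def adj_def)
  then show "top_part m C \<in> cliques X E (card (top_part m C))"
    using C(1) fin by (auto simp: cliques_def top_part_def)
  show "low_part m C \<in> cliques ({..<m} \<times> X) adj (card (low_part m C))"
    using C(1,2) A by (auto simp: cliques_def low_part_def)
  have "card C = card (Pair m ` top_part m C \<union> low_part m C)" using eq by simp
  also have "\<dots> = card (top_part m C) + card (low_part m C)"
    using fin C(2) by (subst card_Un_disjoint) (auto simp: low_part_def card_image inj_on_def)
  finally show "k = card (top_part m C) + card (low_part m C)" using C(3) by simp
qed

text \<open>A clique meets each level in a clique of \<open>E\<close>, which has at most three
  vertices. Configurations attain this bound, so every level carries exactly three tokens.\<close>

lemma no_big_cliques: "C \<in> cliques ({..<m} \<times> X) adj k \<Longrightarrow> k \<le> 3 * m"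
proof (induction m arbitrary: C k)
  case 0
  then show ?case by (auto simp: cliques_def)
next
  case (Suc m)
  have "card (top_part m C) \<le> 3"
    using cliques_card_le[of X E 3] no4 top_low_decomp(2)[OF Suc.prems] by simp
  moreover have "card (low_part m C) \<le> 3 * m"
    using Suc.IH top_low_decomp(3)[OF Suc.prems] by blast
  ultimately show ?case using top_low_decomp(4)[OF Suc.prems] by simp
qed

text \<open>Both sets have \<open>3 * m\<close> elements. Hence a restriction to \<open>S\<close> or
  \<open>T\<close> on each level pins down the entire lower configuration.\<close>

lemma const_subset_eq:
  assumes "D \<in> states m" "s \<in> tri" "D \<subseteq> {..<m} \<times> s"
  shows "D = {..<m} \<times> s"
  using assms triD[OF assms(2)] statesD[OF assms(1)]
  by (intro card_subset_eq) (auto simp: card_cartesian_product)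

text \<open>In an odd block \<open>blk_odd\<close> supplies a vertex that enforces the demand, and
  \<open>type_odd\<close> ensures that no vertex of the triangle demands anything else.\<close>

lemma joins_iff_compat:
  assumes s: "s \<in> tri" and D: "D \<in> states m"
  shows "(\<forall>z\<in>s. \<forall>q\<in>D. joins z (snd q)) \<longleftrightarrow> compat m s D"
proof
  assume J: "\<forall>z\<in>s. \<forall>q\<in>D. joins z (snd q)"
  have D': "D \<subseteq> {..<m} \<times> X" by (rule statesD[OF D])
  show "compat m s D" unfolding compat_def
  proof (intro conjI impI)
    assume b: "blk s mod 4 = 1"
    then have "odd (blk s)" by presburger
    then obtain z where "z \<in> s" "odd (\<tau> z)" using blk_odd[OF s] by blast
    then have "\<tau> z mod 4 = 1" using type_odd[OF s] b by simp
    then have "D \<subseteq> {..<m} \<times> T" using J \<open>z \<in> s\<close> D' by (fastforce simp: joins_def)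
    then show "D = {..<m} \<times> T" by (rule const_subset_eq[OF D T])
  next
    assume b: "blk s mod 4 = 3"
    then have "odd (blk s)" by presburger
    then obtain z where "z \<in> s" "odd (\<tau> z)" using blk_odd[OF s] by blast
    then have "\<tau> z mod 4 = 3" using type_odd[OF s] b by simp
    then have "D \<subseteq> {..<m} \<times> S" using J \<open>z \<in> s\<close> D' by (fastforce simp: joins_def)
    then show "D = {..<m} \<times> S" by (rule const_subset_eq[OF D S])
  qed
next
  assume c: "compat m s D"
  show "\<forall>z\<in>s. \<forall>q\<in>D. joins z (snd q)"
  proof (intro ballI)
    fix z q assume zq: "z \<in> s" "q \<in> D"
    have b: "blk s mod 4 = \<tau> z mod 4" if "odd (\<tau> z)"
      using type_odd[OF s zq(1) that] by simp
    show "joins z (snd q)" unfolding joins_def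
    proof (intro conjI impI)
      assume "\<tau> z mod 4 = 1"
      moreover from this have "odd (\<tau> z)" by presburger
      ultimately have "D = {..<m} \<times> T" using b c by (simp add: compat_def)
      with zq(2) show "snd q \<in> T" by auto
    next
      assume "\<tau> z mod 4 = 3"
      moreover from this have "odd (\<tau> z)" by presburger
      ultimately have "D = {..<m} \<times> S" using b c by (simp add: compat_def)
      with zq(2) show "snd q \<in> S" by auto
    qed
  qed
qed

lemma states_SucI:
  assumes s: "s \<in> tri" and D: "D \<in> states m" and c: "compat m s D"
  shows "Pair m ` s \<union> D \<in> states (Suc m)"
proof -
  have J: "joins z (snd q)" if "z \<in> s" "q \<in> D" for z q
    using joins_iff_compat[OF s D] c that by blast
  have D': "D \<subseteq> {..<m} \<times> X" by (rule statesD[OF D])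
  have "card (Pair m ` s \<union> D) = 3 * Suc m"
    using triD[OF s] statesD[OF D] by (subst card_Un_disjoint) (auto simp: card_image inj_on_def)
  moreover have "adj u v" if uv: "u \<in> Pair m ` s \<union> D" "v \<in> Pair m ` s \<union> D" "u \<noteq> v" for u v
  proof -
    consider "u \<in> Pair m ` s" "v \<in> Pair m ` s" | "u \<in> Pair m ` s" "v \<in> D"
      | "v \<in> Pair m ` s" "u \<in> D" | "u \<in> D" "v \<in> D" using uv by blast
    then show ?thesis
    proof cases
      case 1
      then show ?thesis using s uv(3) by (auto simp: adj_def cliques_def)
    next
      case 2
      then show ?thesis using J D' by (auto simp: adj_def)
    next
      case 3
      then show ?thesis using J D' by (auto simp: adj_def)
    next
      case 4
      then show ?thesis using D uv(3) by (auto simp: states_def cliques_def)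
    qed
  qed
  ultimately show ?thesis
    using triD[OF s] statesD[OF D] by (auto simp: states_def cliques_def less_Suc_eq)
qed

lemma states_SucE:
  assumes "C \<in> states (Suc m)"
  obtains s D where "s \<in> tri" "D \<in> states m" "compat m s D" "C = Pair m ` s \<union> D"
proof -
  have C: "C \<in> cliques ({..<Suc m} \<times> X) adj (3 * Suc m)" using assms by (simp add: states_def)
  note d = top_low_decomp[OF C]
  have "card (top_part m C) \<le> 3" using cliques_card_le[of X E 3] no4 d(2) by simp
  moreover have "card (low_part m C) \<le> 3 * m" using d(3) by (rule no_big_cliques)
  ultimately have c: "card (top_part m C) = 3" "card (low_part m C) = 3 * m" using d(4) by auto
  have s: "top_part m C \<in> tri" and D: "low_part m C \<in> states m" using d c by (simp_all add: states_def)
  have "joins z (snd q)" if "z \<in> top_part m C" "q \<in> low_part m C" for z q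
  proof -
    have "adj (m, z) q" using C that by (auto simp: cliques_def top_part_def low_part_def)
    then show ?thesis using that by (auto simp: adj_def low_part_def)
  qed
  then have "compat m (top_part m C) (low_part m C)" using joins_iff_compat[OF s D] by blast
  with s D d(1) show ?thesis using that by blast
qed

text \<open>The sizes of the intersections on the top level and below add up, and neither exceeds
  its full value; a total deficit of one therefore falls on exactly one of the two parts.\<close>

lemma jump_states_Suc_iff:
  assumes s: "s \<in> tri" "s' \<in> tri" and D: "D \<in> states m" "D' \<in> states m"
    and c: "compat m s D" "compat m s' D'"
  shows "(Pair m ` s \<union> D, Pair m ` s' \<union> D') \<in> jumps (states (Suc m)) \<longleftrightarrow>
    s = s' \<and> (D, D') \<in> jumps (states m) \<or> D = D' \<and> (s, s') \<in> jumps tri"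
proof -
  have sub: "D \<subseteq> {..<m} \<times> X" "D' \<subseteq> {..<m} \<times> X" using statesD D by auto
  have "(Pair m ` s \<union> D) \<inter> (Pair m ` s' \<union> D') = Pair m ` (s \<inter> s') \<union> (D \<inter> D')"
    using sub by auto
  moreover have "card (Pair m ` (s \<inter> s') \<union> (D \<inter> D')) = card (s \<inter> s') + card (D \<inter> D')"
    using sub triD[OF s(1)] statesD[OF D(1)]
    by (subst card_Un_disjoint) (auto simp: card_image inj_on_def)
  ultimately have eq: "card ((Pair m ` s \<union> D) \<inter> (Pair m ` s' \<union> D')) = card (s \<inter> s') + card (D \<inter> D')"
    by simp
  have st: "Pair m ` s \<union> D \<in> states (Suc m)" "Pair m ` s' \<union> D' \<in> states (Suc m)"
    using s D c by (auto intro: states_SucI)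
  have 1: "card (s \<inter> s') \<le> 3" "card (D \<inter> D') \<le> 3 * m"
    using triD[OF s(1)] statesD[OF D(1)] by (metis card_mono inf_le1)+
  have 2: "card (s \<inter> s') = 3 \<longleftrightarrow> s = s'"
    using triD[OF s(1)] triD[OF s(2)] by (metis card_subset_eq inf.idem inf_le1 inf_le2)
  have 3: "card (D \<inter> D') = 3 * m \<longleftrightarrow> D = D'"
    using statesD[OF D(1)] statesD[OF D(2)] by (metis card_subset_eq inf.idem inf_le1 inf_le2)
  have "(Pair m ` s \<union> D, Pair m ` s' \<union> D') \<in> jumps (states (Suc m)) \<longleftrightarrow>
      card (s \<inter> s') + card (D \<inter> D') + 1 = 3 * Suc m"
    using st statesD(3)[OF st(1)] eq by (simp add: jumps_def)
  also have "\<dots> \<longleftrightarrow> card (s \<inter> s') = 3 \<and> card (D \<inter> D') + 1 = 3 * m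
      \<or> card (D \<inter> D') = 3 * m \<and> card (s \<inter> s') + 1 = 3"
    using 1 by auto
  also have "\<dots> \<longleftrightarrow> s = s' \<and> (D, D') \<in> jumps (states m) \<or> D = D' \<and> (s, s') \<in> jumps tri"
    using 2 3 s D triD(3)[OF s(1)] statesD(3)[OF D(1)] by (auto simp: jumps_def)
  finally show ?thesis .
qed

section \<open>Length of the counter and its potential\<close>

fun len :: "nat \<Rightarrow> int" where
  "len 0 = 0"
| "len (Suc m) = (len m + 2) * (int P div 2) + len m"

text \<open>Two blocks account for one traversal of the lower levels and two changes of block, which
  is the factor \<open>len m + 2\<close>; the last summand of \<open>len\<close> is the final
  traversal in block \<open>P\<close>. In an even block progress is that of the lower levels, run
  forwards if 4 divides the block and backwards otherwise; in an odd block their traversal is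
  complete.\<close>

fun pot :: "nat \<Rightarrow> (nat \<times> 'a) set \<Rightarrow> int" where
  "pot 0 C = 0"
| "pot (Suc m) C = (len m + 2) * (int (blk (top_part m C)) div 2) +
     (if odd (blk (top_part m C)) then len m + 1
      else if 4 dvd blk (top_part m C) then pot m (low_part m C)
      else len m - pot m (low_part m C))"

lemma states_const: "{..<m} \<times> S \<in> states m \<and> {..<m} \<times> T \<in> states m"
proof (induction m)
  case 0
  then show ?case by (simp add: states_def cliques_def)
next
  case (Suc m)
  have eq: "{..<Suc m} \<times> A = Pair m ` A \<union> {..<m} \<times> A" for A by (auto simp: less_Suc_eq)
  have "P mod 4 = 0" using P by presburger
  then show ?case unfolding eq
    using Suc S T by (auto intro!: states_SucI simp: compat_def blk_S blk_T)
qed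

lemma pot_const: "pot m ({..<m} \<times> S) = 0 \<and> pot m ({..<m} \<times> T) = len m"
proof (induction m)
  case (Suc m)
  have eq: "{..<Suc m} \<times> A = Pair m ` A \<union> {..<m} \<times> A" for A by (auto simp: less_Suc_eq)
  have S': "{..<m} \<times> S \<subseteq> {..<m} \<times> X" and T': "{..<m} \<times> T \<subseteq> {..<m} \<times> X"
    using triD(1)[OF S] triD(1)[OF T] by auto
  have "even P" using P by presburger
  then show ?case unfolding eq using Suc P S' T' by (simp add: blk_S blk_T)
qed simp

lemma pot_jump:
  assumes "(C, C') \<in> jumps (states m)"
  shows "\<bar>pot m C' - pot m C\<bar> \<le> 1"
  using assms
proof (induction m arbitrary: C C')
  case (Suc m)
  obtain s D where C: "s \<in> tri" "D \<in> states m" "compat m s D" "C = Pair m ` s \<union> D"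
    using Suc.prems by (auto simp: jumps_def elim: states_SucE)
  obtain s' D' where C': "s' \<in> tri" "D' \<in> states m" "compat m s' D'" "C' = Pair m ` s' \<union> D'"
    using Suc.prems by (auto simp: jumps_def elim: states_SucE)
  have tl: "top_part m C = s" "low_part m C = D" "top_part m C' = s'" "low_part m C' = D'"
    using statesD(1)[OF C(2)] statesD(1)[OF C'(2)] C(4) C'(4) by auto
  consider (lower) "s = s'" "(D, D') \<in> jumps (states m)" | (upper) "D = D'" "(s, s') \<in> jumps tri"
    using jump_states_Suc_iff[OF C(1) C'(1) C(2) C'(2) C(3) C'(3)] Suc.prems C(4) C'(4) by auto
  then show ?case
  proof cases
    case lower
    then have "\<bar>pot m D' - pot m D\<bar> \<le> 1" by (intro Suc.IH)
    then show ?thesis using lower(1) by (auto simp: tl)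
  next
    case upper
    \<comment> \<open>An upper jump inside a block leaves the potential unchanged. With the absolute
      value, moving one block up also covers moving one block down.\<close>
    have step: "\<bar>pot (Suc m) (Pair m ` s2 \<union> D) - pot (Suc m) (Pair m ` s1 \<union> D)\<bar> \<le> 1"
      if b: "blk s2 = Suc (blk s1)" and c: "compat m s1 D" "compat m s2 D" for s1 s2
    proof -
      have tl': "top_part m (Pair m ` s1 \<union> D) = s1" "low_part m (Pair m ` s1 \<union> D) = D"
        "top_part m (Pair m ` s2 \<union> D) = s2" "low_part m (Pair m ` s2 \<union> D) = D"
        using statesD(1)[OF C(2)] by auto
      \<comment> \<open>Of two consecutive blocks one is odd and determines \<open>D\<close>: it is
        \<open>T\<close> on every level if the residue is 1 and \<open>S\<close> if it is 3, with
        potentials \<open>len m\<close> and 0.\<close>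
      have potD: "pot m D = (if blk s1 mod 4 = 0 \<or> blk s1 mod 4 = 1 then len m else 0)"
      proof -
        have "blk s1 mod 4 = 0 \<and> blk s2 mod 4 = 1 \<or> blk s1 mod 4 = 1 \<or>
            blk s1 mod 4 = 2 \<and> blk s2 mod 4 = 3 \<or> blk s1 mod 4 = 3"
          using b by presburger
        then show ?thesis using c pot_const[of m] by (elim disjE conjE) (simp_all add: compat_def)
      qed
      obtain q r where qr: "blk s1 = 4 * q + r" "r < 4"
        by (metis mult_div_mod_eq mod_less_divisor zero_less_numeral)
      then consider "r = 0" | "r = 1" | "r = 2" | "r = 3" by linarith
      then show ?thesis
      proof cases
        case 1
        then show ?thesis using potD by (simp add: tl' qr b)
      next
        case 2
        then have *: "int (blk s1) div 2 = 2 * int q" "int (blk s2) div 2 = 2 * int q + 1"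
          "odd (blk s1)" "even (blk s2)" "\<not> 4 dvd blk s2" "blk s1 mod 4 = 1"
          using qr b by presburger+
        show ?thesis using potD unfolding pot.simps tl' * using *
          by (simp add: algebra_simps)
      next
        case 3
        then have *: "int (blk s1) div 2 = 2 * int q + 1" "int (blk s2) div 2 = 2 * int q + 1"
          "even (blk s1)" "odd (blk s2)" "\<not> 4 dvd blk s1" "blk s1 mod 4 = 2"
          using qr b by presburger+
        show ?thesis using potD unfolding pot.simps tl' * using *
          by (simp add: algebra_simps)
      next
        case 4
        then have *: "int (blk s1) div 2 = 2 * int q + 1" "int (blk s2) div 2 = 2 * int q + 2"
          "odd (blk s1)" "even (blk s2)" "4 dvd blk s2" "blk s1 mod 4 = 3"
          using qr b by presburger+
        show ?thesis using potD unfolding pot.simps tl' * using *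
          by (simp add: algebra_simps)
      qed
    qed
    have "blk s' \<le> blk s + 1" "blk s \<le> blk s' + 1"
      using blk_jump upper(2) jumps_sym by blast+
    then consider "blk s = blk s'" | "blk s' = Suc (blk s)" | "blk s = Suc (blk s')" by linarith
    then show ?thesis
    proof cases
      case 1
      then show ?thesis using upper(1) by (simp add: tl)
    next
      case 2
      then show ?thesis using step[of s' s] C(3,4) C'(3,4) upper(1) by blast
    next
      case 3
      then show ?thesis using step[of s s'] C(3,4) C'(3,4) upper(1)
        by (simp only: abs_minus_commute) 
    qed
  qed
qed simp

section \<open>Reaching the final configuration\<close>

lemma states_connected: "({..<m} \<times> S, {..<m} \<times> T) \<in> (jumps (states m))\<^sup>*"
proof (induction m)
  case (Suc m)
  let ?S = "{..<m} \<times> S" and ?T = "{..<m} \<times> T" and ?J = "jumps (states (Suc m))"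
  have cS: "?S \<in> states m" and cT: "?T \<in> states m" using states_const by auto
  \<comment> \<open>An even block demands nothing, so the lower levels can run their whole walk in
    either direction.\<close>
  have free: "(Pair m ` s \<union> D, Pair m ` s \<union> D') \<in> ?J\<^sup>*"
    if s: "s \<in> tri" "even (blk s)" and D: "D \<in> {?S, ?T}" "D' \<in> {?S, ?T}" for s D D'
  proof -
    have comp: "compat m s C" for C
    proof -
      have "blk s mod 4 \<noteq> 1" "blk s mod 4 \<noteq> 3" using s(2) by presburger+
      then show ?thesis by (simp add: compat_def)
    qed
    have "(D, D') \<in> (jumps (states m))\<^sup>*"
      using D Suc.IH jumps_rtrancl_sym[of ?S ?T] unfolding states_def by auto
    then show ?thesis
    proof (induction rule: rtrancl_induct)
      case (step C C')
      then have "(Pair m ` s \<union> C, Pair m ` s \<union> C') \<in> ?J"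
        using jump_states_Suc_iff[OF s(1) s(1)] comp by (auto simp: jumps_def)
      with step.IH show ?case by (rule rtrancl_into_rtrancl)
    qed simp
  qed
  \<comment> \<open>It suffices to follow the two constant lower configurations along the upper
    walk, since these are what odd blocks demand.\<close>
  have reach: "s \<in> tri \<and> (\<forall>D\<in>{?S, ?T}. compat m s D \<longrightarrow> (Pair m ` S \<union> ?S, Pair m ` s \<union> D) \<in> ?J\<^sup>*)"
    if "(S, s) \<in> (jumps tri)\<^sup>*" for s
    using that
  proof (induction rule: rtrancl_induct)
    case base
    show ?case using free[OF S, of ?S] S by (auto simp: blk_S)
  next
    case (step s s')
    have s': "s' \<in> tri" and s: "s \<in> tri" using step.hyps by (auto simp: jumps_def)
    have move: "(Pair m ` S \<union> ?S, Pair m ` s' \<union> D) \<in> ?J\<^sup>*"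
      if D: "D \<in> {?S, ?T}" "compat m s D" "compat m s' D" for D
    proof -
      have "(Pair m ` s \<union> D, Pair m ` s' \<union> D) \<in> ?J"
        using jump_states_Suc_iff[OF s s'] step.hyps(2) D cS cT by auto
      moreover have "(Pair m ` S \<union> ?S, Pair m ` s \<union> D) \<in> ?J\<^sup>*" using step.IH D by blast
      ultimately show ?thesis by (rule rtrancl_into_rtrancl[rotated])
    qed
    have le: "blk s' \<le> blk s + 1" "blk s \<le> blk s' + 1"
      using blk_jump step.hyps(2) jumps_sym by blast+
    have "(Pair m ` S \<union> ?S, Pair m ` s' \<union> D) \<in> ?J\<^sup>*" if D: "D \<in> {?S, ?T}" "compat m s' D" for D
    proof (cases "compat m s D")
      case True
      then show ?thesis using move D by blast
    next
      case False
      \<comment> \<open>\<open>D\<close> violates the demand of \<open>s\<close> but not that of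
        \<open>s'\<close>, so the jump leaves an odd block for an even one. It is made with the
        configuration demanded by \<open>s\<close>, which is changed to \<open>D\<close>
        afterwards.\<close>
      then have "blk s \<noteq> blk s'" using D(2) by (auto simp: compat_def)
      moreover have "odd (blk s)"
      proof -
        have "blk s mod 4 = 1 \<or> blk s mod 4 = 3" using False by (auto simp: compat_def)
        then show ?thesis by presburger
      qed
      ultimately have ev: "even (blk s')" using le by (metis Suc_eq_plus1 even_Suc le_Suc_eq le_antisym)
      have comp': "compat m s' C" for C
      proof -
        have "blk s' mod 4 \<noteq> 1" "blk s' mod 4 \<noteq> 3" using ev by presburger+
        then show ?thesis by (simp add: compat_def)
      qed
      have "\<exists>C\<in>{?S, ?T}. compat m s C" by (cases "blk s mod 4 = 1") (auto simp: compat_def)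
      then obtain C where "C \<in> {?S, ?T}" "compat m s C" by blast
      then have "(Pair m ` S \<union> ?S, Pair m ` s' \<union> C) \<in> ?J\<^sup>*" using move comp' by blast
      moreover have "(Pair m ` s' \<union> C, Pair m ` s' \<union> D) \<in> ?J\<^sup>*"
        using free[OF s' ev] \<open>C \<in> _\<close> D(1) by blast
      ultimately show ?thesis by (rule rtrancl_trans)
    qed
    with s' show ?case by blast
  qed
  have "P mod 4 = 0" using P by presburger
  then have "compat m T ?T" by (simp add: compat_def blk_T)
  then have "(Pair m ` S \<union> ?S, Pair m ` T \<union> ?T) \<in> ?J\<^sup>*" using reach[OF ST] by blast
  moreover have eq: "{..<Suc m} \<times> A = Pair m ` A \<union> {..<m} \<times> A" for A by (auto simp: less_Suc_eq)
  ultimately show ?case by (simp only: eq)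
qed simp

lemma len_nonneg: "0 \<le> len m"
  by (induction m) auto

text \<open>The induction runs with \<open>len m + 1\<close>, because for \<open>m = 0\<close> the
  power is 1 while \<open>len\<close> is 0.\<close>

lemma len_ge:
  assumes "m \<noteq> 0"
  shows "(int P div 2) ^ m \<le> len m"
proof -
  have *: "(int P div 2) ^ m \<le> len m + 1" for m
  proof (induction m)
    case (Suc m)
    have "(int P div 2) ^ Suc m \<le> (len m + 2) * (int P div 2)"
      using mult_right_mono[OF Suc, of "int P div 2"] by (simp add: algebra_simps)
    then show ?case using len_nonneg[of m] by simp
  qed simp
  obtain l where m: "m = Suc l" using assms by (metis not0_implies_Suc)
  have "(int P div 2) ^ Suc l \<le> (len l + 2) * (int P div 2)"
    using mult_right_mono[OF *[of l], of "int P div 2"] by (simp add: algebra_simps)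
  then show ?thesis using len_nonneg[of l] by (simp add: m)
qed

theorem max_config_diameter_ge:
  assumes m: "m \<noteq> 0" and n: "m * card X + j \<le> n"
  shows "ereal ((real P / 2) ^ m) \<le> max_config_diameter n (3 * m + j)"
proof -
  have "(int P div 2) ^ m \<le> len m" using m by (rule len_ge)
  moreover have "real_of_int (int P div 2) = real P / 2" using P by (auto elim!: dvdE)
  ultimately have "(real P / 2) ^ m \<le> real_of_int (len m)"
    by (metis of_int_le_iff of_int_power)
  then have "ereal ((real P / 2) ^ m) \<le> ereal (pot m ({..<m} \<times> T) - pot m ({..<m} \<times> S))"
    using pot_const[of m] by simp
  also have "\<dots> \<le> max_config_diameter n (3 * m + j)"
  proof (rule clique_potential_le_max_config_diameter[where X = "{..<m} \<times> X" and E = adj])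
    show "finite ({..<m} \<times> X)" using finite_X by simp
    show "adj u v \<Longrightarrow> adj v u" for u v by (rule adj_sym)
    show "cliques ({..<m} \<times> X) adj (Suc (3 * m)) = {}" using no_big_cliques by fastforce
    show "{..<m} \<times> S \<in> cliques ({..<m} \<times> X) adj (3 * m)"
      using states_const by (simp add: states_def)
    show "({..<m} \<times> S, {..<m} \<times> T) \<in> (jumps (cliques ({..<m} \<times> X) adj (3 * m)))\<^sup>*"
      using states_connected by (simp add: states_def)
    show "pot m J \<le> pot m I + 1" if "(I, J) \<in> jumps (cliques ({..<m} \<times> X) adj (3 * m))" for I J
      using pot_jump[of I J m] that by (simp add: states_def abs_le_iff)
    show "card ({..<m} \<times> X) + j \<le> n" using n by (simp add: card_cartesian_product)
    show "2 \<le> 3 * m + j \<or> card ({..<m} \<times> X) + j = n" using m by simp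
  qed
  finally show ?thesis .
qed

end

section \<open>A triangle gadget\<close>

datatype vertex = U nat | V nat | W nat | TU nat | SV nat

fun colour :: "vertex \<Rightarrow> nat" where
  "colour (U _) = 0"
| "colour (TU _) = 0"
| "colour (V _) = 1"
| "colour (SV _) = 1"
| "colour (W _) = 2"

text \<open>
  Row \<open>i\<close> is the strip of triangles \<open>{U x, V (x + a i), W (x + 2 a i)}\<close>, consecutive members being
  joined by two intermediate triangles.  Since \<open>a\<close> has no three-term progression, an edge
  determines its row, as in the Ruzsa--Szemeredi construction; the values of \<open>a\<close> are multiples of 4,
  so that the defects \<open>Suc\<close> on edges create no further triangles.  The rows are traversed alternately
  upwards and downwards; \<open>TU j\<close> and \<open>SV j\<close> serve only to turn from row \<open>j\<close> into row \<open>j + 1\<close>.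
\<close>

locale rows =
  fixes a :: "nat \<Rightarrow> nat" and h q N :: nat
  assumes dvd_a: "i \<le> 2 * q \<Longrightarrow> 4 dvd a i"
    and a_less: "i \<le> 2 * q \<Longrightarrow> a i < 4 * N"
    and a_free: "i \<le> 2 * q \<Longrightarrow> j \<le> 2 * q \<Longrightarrow> l \<le> 2 * q \<Longrightarrow> a i + a j = 2 * a l \<Longrightarrow> i = l \<and> j = l"
begin

definition M :: nat where "M = 4 * h + 1"

text \<open>The offset of \<open>V\<close> and \<open>W\<close> where the traversal of row
  \<open>j\<close> stops. Downwards it is 0 and not 1, since the last triangle is
  \<open>{U 1, V (a j), W (2 * a j)}\<close>.\<close>

definition turn_end :: "nat \<Rightarrow> nat" where "turn_end j = (if even j then M else 0)"

text \<open>Turning changes both \<open>V\<close> and \<open>W\<close>, which a single jump cannot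
  do. So \<open>TU j\<close> replaces \<open>U\<close>, then \<open>SV j\<close> replaces
  \<open>V\<close>; now \<open>W\<close> can change rows, and the two replacements are undone in the
  next row.\<close>

fun arc :: "vertex \<Rightarrow> vertex \<Rightarrow> bool" where
  "arc (U x) (V p) \<longleftrightarrow> (\<exists>i\<le>2 * q. p = x + a i \<or> Suc p = x + a i)"
| "arc (U x) (W w) \<longleftrightarrow> (\<exists>i\<le>2 * q. w = x + 2 * a i \<or> Suc w = x + 2 * a i)"
| "arc (V p) (W w) \<longleftrightarrow> (\<exists>i\<le>2 * q. w = p + a i \<or> Suc w = p + a i)"
| "arc (TU j) (V p) \<longleftrightarrow> (\<exists>i\<in>{j, Suc j}. p = turn_end j + a i)"
| "arc (TU j) (W w) \<longleftrightarrow> (\<exists>i\<in>{j, Suc j}. w = turn_end j + 2 * a i)"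
| "arc (TU j) (SV k) \<longleftrightarrow> j = k"
| "arc (SV j) (W w) \<longleftrightarrow> (\<exists>i\<in>{j, Suc j}. w = turn_end j + 2 * a i)"
| "arc _ _ \<longleftrightarrow> False"

definition E :: "vertex \<Rightarrow> vertex \<Rightarrow> bool" where "E u v \<longleftrightarrow> arc u v \<or> arc v u"

definition X :: "vertex set" where
  "X = U ` {1..M} \<union> V ` {..<M + 4 * N} \<union> W ` {..<M + 8 * N} \<union> TU ` {..<2 * q} \<union> SV ` {..<2 * q}"

text \<open>A row has \<open>M\<close> blocks, one for each \<open>x\<close>, and the turn after it
  is one more, hence \<open>M + 1\<close>. The triangles of a row at the same \<open>U x\<close>
  share a block, so the type of \<open>U x\<close> can mark it.\<close>

definition pos :: "nat \<Rightarrow> nat \<Rightarrow> nat" where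
  "pos i x = i * (M + 1) + (if even i then x - 1 else M - x)"

text \<open>A relation rather than a function, as a triangle does not visibly determine its
  parameters; uniqueness of the block comes from \<open>tri_block_share\<close>.\<close>

inductive tri_block :: "vertex set \<Rightarrow> nat \<Rightarrow> bool" where
  row: "i \<le> 2 * q \<Longrightarrow> 1 \<le> x \<Longrightarrow> x \<le> M \<Longrightarrow> p = x + a i \<or> Suc p = x + a i \<Longrightarrow>
    w = p + a i \<or> Suc w = p + a i \<Longrightarrow> w = x + 2 * a i \<or> Suc w = x + 2 * a i \<Longrightarrow>
    tri_block {U x, V p, W w} (pos i x)"
| turn_V: "j < 2 * q \<Longrightarrow> i = j \<or> i = Suc j \<Longrightarrow>
    tri_block {TU j, V (turn_end j + a i), W (turn_end j + 2 * a i)} (j * (M + 1) + M)"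
| turn_SV: "j < 2 * q \<Longrightarrow> i = j \<or> i = Suc j \<Longrightarrow>
    tri_block {TU j, SV j, W (turn_end j + 2 * a i)} (j * (M + 1) + M)"

definition blk :: "vertex set \<Rightarrow> nat" where "blk C = (SOME b. tri_block C b)"

fun type_of :: "vertex \<Rightarrow> nat" where
  "type_of (U x) = x - 1"
| "type_of (TU j) = (if even j then 1 else 3)"
| "type_of _ = 0"

section \<open>Colours and classification of triangles\<close>

lemma arc_colour: "arc u v \<Longrightarrow> colour u < colour v"
  by (induction u v rule: arc.induct) auto

lemma E_iff_arc: "colour u < colour v \<Longrightarrow> E u v \<longleftrightarrow> arc u v"
  using arc_colour[of v u] by (auto simp: E_def)

lemma colour_inj: "C \<in> cliques X E k \<Longrightarrow> inj_on colour C"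
  using arc_colour by (fastforce simp: inj_on_def cliques_def E_def)

lemma colour_le: "colour u \<le> 2"
  by (cases u) auto

lemma no4: "cliques X E 4 = {}"
proof -
  have False if C: "C \<in> cliques X E 4" for C
  proof -
    have "card (colour ` C) = 4" using C colour_inj[OF C] by (simp add: card_image cliques_def)
    moreover have "card (colour ` C) \<le> card {..2::nat}"
      using colour_le by (intro card_mono) auto
    ultimately show False by simp
  qed
  then show ?thesis by blast
qed

lemma tri_cases:
  assumes C: "C \<in> cliques X E 3"
  obtains u v w where "C = {u, v, w}" "{u, v, w} \<subseteq> X" "colour u = 0" "colour v = 1" "colour w = 2"
    "arc u v" "arc u w" "arc v w"
proof -
  have card: "card C = 3" "C \<subseteq> X" "finite C" using C by (auto simp: cliques_def)
  have "card (colour ` C) = card {..2::nat}"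
    using card colour_inj[OF C] by (simp add: card_image)
  then have img: "colour ` C = {..2}" using colour_le by (intro card_subset_eq) auto
  then have "0 \<in> colour ` C" "1 \<in> colour ` C" "2 \<in> colour ` C" by simp_all
  then obtain u v w where uvw: "u \<in> C" "v \<in> C" "w \<in> C" "colour u = 0" "colour v = 1" "colour w = 2"
    by force
  then have ne: "u \<noteq> v" "u \<noteq> w" "v \<noteq> w" by auto
  then have "card {u, v, w} = card C" using card by simp
  then have "{u, v, w} = C" using uvw card by (intro card_subset_eq) auto
  moreover have "E u v" "E u w" "E v w" using C uvw ne by (auto simp: cliques_def)
  then have "arc u v" "arc u w" "arc v w" using uvw E_iff_arc by auto
  ultimately show ?thesis using that uvw card by blast
qed

lemma triI:
  assumes "u \<in> X" "v \<in> X" "w \<in> X" "colour u = 0" "colour v = 1" "colour w = 2"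
    "arc u v" "arc u w" "arc v w"
  shows "{u, v, w} \<in> cliques X E 3"
proof -
  have "u \<noteq> v" "u \<noteq> w" "v \<noteq> w" using assms by auto
  then show ?thesis using assms by (auto simp: cliques_def E_def)
qed

lemma a_inj_near:
  assumes "i \<le> 2 * q" "j \<le> 2 * q" "a i \<le> a j + 3" "a j \<le> a i + 3"
  shows "i = j"
proof -
  have "a i = a j" using dvd_a[OF assms(1)] dvd_a[OF assms(2)] assms(3,4) by presburger
  then show ?thesis using a_free[of i j j] assms(1,2) by simp
qed

text \<open>Going around the three edges gives \<open>a i + a j = 2 * a l\<close> up to an error of
  at most 2. All values are multiples of 4, so the error vanishes and \<open>a_free\<close>
  applies.\<close>

lemma row_unique:
  assumes i: "i \<le> 2 * q" and j: "j \<le> 2 * q" and l: "l \<le> 2 * q"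
    and "p = x + a i \<or> Suc p = x + a i" "w = p + a j \<or> Suc w = p + a j"
    "w = x + 2 * a l \<or> Suc w = x + 2 * a l"
  shows "i = l \<and> j = l"
proof -
  obtain i' j' l' where 4: "a i = 4 * i'" "a j = 4 * j'" "a l = 4 * l'"
    using dvd_a[OF i] dvd_a[OF j] dvd_a[OF l] by (auto elim!: dvdE)
  have *: "\<exists>e\<le>1. u + e = v" if "u = v \<or> Suc u = v" for u v :: nat
    using that by (metis Suc_eq_plus1 add_0_right le_numeral_extra(4) zero_le_one)
  obtain e1 e2 e3 where e: "e1 \<le> 1" "p + e1 = x + a i" "e2 \<le> 1" "w + e2 = p + a j"
    "e3 \<le> 1" "w + e3 = x + 2 * a l"
    using *[OF assms(4)] *[OF assms(5)] *[OF assms(6)] by blast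
  then have "4 * (i' + j') + e3 = 4 * (2 * l') + (e1 + e2)" unfolding 4 by simp
  then have "i' + j' = 2 * l'" using e(1,3,5) by presburger
  then have "a i + a j = 2 * a l" by (simp add: 4)
  then show ?thesis using a_free i j l by blast
qed

lemma tri_block_exists:
  assumes C: "C \<in> cliques X E 3"
  shows "\<exists>b. tri_block C b"
proof -
  obtain u v w where uvw: "C = {u, v, w}" "{u, v, w} \<subseteq> X" "colour u = 0" "colour v = 1"
    "colour w = 2" and arcs: "arc u v" "arc u w" "arc v w"
    by (rule tri_cases[OF C])
  obtain r where w: "w = W r" using uvw(5) by (cases w) auto
  consider (U) x where "u = U x" | (TU) j where "u = TU j" using uvw(3) by (cases u) auto
  then show ?thesis
  proof cases
    case U
    then obtain p where v: "v = V p" using uvw(4) arcs(1) by (cases v) auto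
    obtain i j l where ijl: "i \<le> 2 * q" "j \<le> 2 * q" "l \<le> 2 * q"
      "p = x + a i \<or> Suc p = x + a i" "r = p + a j \<or> Suc r = p + a j"
      "r = x + 2 * a l \<or> Suc r = x + 2 * a l"
      using arcs unfolding U v w arc.simps by blast
    then have "i = l" "j = l" using row_unique by blast+
    moreover have "1 \<le> x" "x \<le> M" using uvw(2) by (auto simp: U X_def)
    ultimately have "tri_block C (pos l x)"
      unfolding uvw(1) U v w using ijl by (intro row) auto
    then show ?thesis ..
  next
    case TU
    have j: "j < 2 * q" using uvw(2) by (auto simp: TU X_def)
    from arcs(2) obtain i where i: "i = j \<or> i = Suc j" "r = turn_end j + 2 * a i"
      by (auto simp: TU w)
    consider (V) p where "v = V p" | (SV) k where "v = SV k" using uvw(4) by (cases v) auto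
    then show ?thesis
    proof cases
      case V
      from arcs(1) obtain i' where i': "i' = j \<or> i' = Suc j" "p = turn_end j + a i'"
        by (auto simp: TU V)
      from arcs(3) obtain l where l: "l \<le> 2 * q" "r = p + a l \<or> Suc r = p + a l"
        by (auto simp: V w)
      have le: "i \<le> 2 * q" "i' \<le> 2 * q" using i i' j by auto
      \<comment> \<open>A turning triangle satisfies the equations of a row triangle with
        \<open>turn_end j\<close> in place of \<open>x\<close>.\<close>
      have "i' = i" using row_unique[OF le(2) l(1) le(1) _ l(2), of "turn_end j"] i i' by simp
      then have "tri_block C (j * (M + 1) + M)"
        unfolding uvw(1) TU V w using turn_V[OF j i(1)] i(2) i'(2) \<open>i' = i\<close> by simp
      then show ?thesis ..
    next
      case SV
      then have "tri_block C (j * (M + 1) + M)"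
        unfolding uvw(1) TU w using turn_SV[OF j i(1)] i(2) arcs(1) by (simp add: TU)
      then show ?thesis ..
    qed
  qed
qed

section \<open>Blocks of triangles that share two vertices\<close>

lemma row_row:
  assumes "i \<le> 2 * q" "1 \<le> x" "x \<le> M" "p = x + a i \<or> Suc p = x + a i"
    "w = p + a i \<or> Suc w = p + a i" "w = x + 2 * a i \<or> Suc w = x + 2 * a i"
    and "i' \<le> 2 * q" "1 \<le> x'" "x' \<le> M" "p' = x' + a i' \<or> Suc p' = x' + a i'"
    "w' = p' + a i' \<or> Suc w' = p' + a i'" "w' = x' + 2 * a i' \<or> Suc w' = x' + 2 * a i'"
    and "x = x' \<and> p = p' \<or> x = x' \<and> w = w' \<or> p = p' \<and> w = w'"
  shows "i = i'" "pos i' x' \<le> pos i x + 1" "x = x' \<Longrightarrow> pos i' x' = pos i x"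
proof -
  \<comment> \<open>Each kind of edge determines \<open>a i\<close>, or \<open>2 * a i\<close>, up
    to an error of at most 1, which is enough by \<open>a_inj_near\<close>.\<close>
  show i: "i = i'" using assms(13)
  proof (elim disjE)
    assume "x = x' \<and> p = p'"
    then show ?thesis using assms(1,4,7,10) by (intro a_inj_near) auto
  next
    assume "x = x' \<and> w = w'"
    then show ?thesis using assms(1,6,7,12) by (intro a_inj_near) auto
  next
    assume "p = p' \<and> w = w'"
    then show ?thesis using assms(1,5,7,11) by (intro a_inj_near) auto
  qed
  have "x' \<le> x + 1 \<and> x \<le> x' + 1" using assms(4,10,13) i by auto
  then show "pos i' x' \<le> pos i x + 1" using i assms(2,3,8,9) by (auto simp: pos_def)
  show "pos i' x' = pos i x" if "x = x'" using that i by simp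
qed

lemma row_turn:
  assumes "i \<le> 2 * q" "1 \<le> x" "x \<le> M" "p = x + a i \<or> Suc p = x + a i"
    "w = p + a i \<or> Suc w = p + a i"
    and "j < 2 * q" "i' = j \<or> i' = Suc j" "p = turn_end j + a i'" "w = turn_end j + 2 * a i'"
  shows "pos i x \<le> j * (M + 1) + M + 1" "j * (M + 1) + M \<le> pos i x + 1"
proof -
  have i: "i = i'" using assms by (intro a_inj_near) auto
  have x: "x = turn_end j \<or> x = Suc (turn_end j)" using assms(4,8) i by auto
  \<comment> \<open>Of the two candidates for \<open>x\<close> only one lies between 1 and
    \<open>M\<close>. There row \<open>j\<close> sits one block before the turning block and row
    \<open>j + 1\<close> one block after it.\<close>
  have "pos i x \<le> j * (M + 1) + M + 1 \<and> j * (M + 1) + M \<le> pos i x + 1"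
  proof (cases "even j")
    case True
    then have "x = M" using x assms(3) by (auto simp: turn_end_def)
    then show ?thesis using True i assms(7) by (auto simp: pos_def)
  next
    case False
    then have "x = 1" using x assms(2) by (auto simp: turn_end_def)
    then show ?thesis using False i assms(7) by (auto simp: pos_def M_def)
  qed
  then show "pos i x \<le> j * (M + 1) + M + 1" "j * (M + 1) + M \<le> pos i x + 1" by auto
qed

text \<open>The common edge determines the row \<open>i\<close> and the parity of \<open>j\<close>;
  as \<open>i\<close> is \<open>j\<close> or \<open>j + 1\<close>, only one \<open>j\<close>
  remains.\<close>

lemma turn_turn:
  assumes "j < 2 * q" "i = j \<or> i = Suc j" "j' < 2 * q" "i' = j' \<or> i' = Suc j'"
    and "turn_end j + a i = turn_end j' + a i'" "turn_end j + 2 * a i = turn_end j' + 2 * a i'"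
  shows "j = j'"
proof -
  have "a i = a i'" "turn_end j = turn_end j'" using assms(5,6) by auto
  then have "i = i'" using assms(1-4) by (intro a_inj_near) auto
  moreover have "even j \<longleftrightarrow> even j'" using \<open>turn_end j = turn_end j'\<close>
    by (auto simp: turn_end_def M_def split: if_splits)
  ultimately show ?thesis using assms(2,4) by auto
qed

text \<open>A common edge leaves only the same row, the same turn, or a turn and the end of an
  adjacent row. The second conclusion is meant for \<open>C = C'\<close>, where it makes
  \<open>blk\<close> well defined.\<close>

lemma tri_block_share:
  assumes "tri_block C b" "tri_block C' b'" "u \<in> C \<inter> C'" "v \<in> C \<inter> C'" "u \<noteq> v"
  shows "b' \<le> b + 1" "(\<forall>x. U x \<in> C \<longleftrightarrow> U x \<in> C') \<Longrightarrow> b' = b"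
proof -
  have "b' \<le> b + 1 \<and> ((\<forall>x. U x \<in> C \<longleftrightarrow> U x \<in> C') \<longrightarrow> b' = b)"
    using assms(1)
  proof cases
    case r: (row i x p w)
    from assms(2) show ?thesis
    proof cases
      case r': (row i' x' p' w')
      have "x = x' \<and> p = p' \<or> x = x' \<and> w = w' \<or> p = p' \<and> w = w'"
        using assms(3-5) unfolding r r' by auto
      from row_row[OF r(3-8) r'(3-8) this] show ?thesis unfolding r r' by auto
    next
      case t: (turn_V j i')
      have "p = turn_end j + a i'" "w = turn_end j + 2 * a i'"
        using assms(3-5) unfolding r t by auto
      from row_turn[OF r(3-7) t(3,4) this] show ?thesis unfolding r t by auto
    next
      case t: (turn_SV j i')
      then show ?thesis using assms(3-5) unfolding r t by auto
    qed
  next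
    case r: (turn_V j i)
    from assms(2) show ?thesis
    proof cases
      case r': (row i' x' p' w')
      have "p' = turn_end j + a i" "w' = turn_end j + 2 * a i"
        using assms(3-5) unfolding r r' by auto
      from row_turn[OF r'(3-7) r(3,4) this] show ?thesis unfolding r r' by auto
    next
      case t: (turn_V j' i')
      have "j = j' \<or> turn_end j + a i = turn_end j' + a i' \<and>
          turn_end j + 2 * a i = turn_end j' + 2 * a i'"
        using assms(3-5) unfolding r t by auto
      then have "j = j'" using turn_turn[OF r(3,4) t(3,4)] by blast
      then show ?thesis unfolding r t by auto
    next
      case t: (turn_SV j' i')
      have "j = j'" using assms(3-5) unfolding r t by auto
      then show ?thesis unfolding r t by auto
    qed
  next
    case r: (turn_SV j i)
    from assms(2) show ?thesis
    proof cases
      case r': (row i' x' p' w')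
      then show ?thesis using assms(3-5) unfolding r r' by auto
    next
      case t: (turn_V j' i')
      have "j = j'" using assms(3-5) unfolding r t by auto
      then show ?thesis unfolding r t by auto
    next
      case t: (turn_SV j' i')
      have "j = j'" using assms(3-5) unfolding r t by auto
      then show ?thesis unfolding r t by auto
    qed
  qed
  then show "b' \<le> b + 1" "(\<forall>x. U x \<in> C \<longleftrightarrow> U x \<in> C') \<Longrightarrow> b' = b" by auto
qed

lemma card_ge_2E:
  assumes "2 \<le> card A"
  obtains u v where "u \<in> A" "v \<in> A" "u \<noteq> v"
proof -
  obtain B where "B \<subseteq> A" "card B = 2" using assms by (meson obtain_subset_with_card_n)
  then show ?thesis using that by (auto simp: card_2_iff)
qed

lemma tri_block_blk: "C \<in> cliques X E 3 \<Longrightarrow> tri_block C (blk C)"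
  unfolding blk_def by (rule someI_ex) (rule tri_block_exists)

lemma blk_eq:
  assumes "C \<in> cliques X E 3" "tri_block C b"
  shows "blk C = b"
proof -
  have "2 \<le> card C" using assms(1) by (simp add: cliques_def)
  then obtain u v where "u \<in> C" "v \<in> C" "u \<noteq> v" by (rule card_ge_2E)
  then show ?thesis using tri_block_share(2)[OF assms(2) tri_block_blk[OF assms(1)]] by blast
qed

lemma blk_jump:
  assumes "(C, C') \<in> jumps (cliques X E 3)"
  shows "blk C' \<le> blk C + 1"
proof -
  have C: "C \<in> cliques X E 3" "C' \<in> cliques X E 3" using assms by (auto simp: jumps_def)
  have "card (C \<inter> C') + 1 = 3" using assms by (auto simp: jumps_def cliques_def)
  then have "2 \<le> card (C \<inter> C')" by simp
  then obtain u v where "u \<in> C \<inter> C'" "v \<in> C \<inter> C'" "u \<noteq> v" by (rule card_ge_2E)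
  then show ?thesis using tri_block_share(1) tri_block_blk C by blast
qed

section \<open>Blocks and types modulo 4\<close>

lemma turn_mod_4: "(j * (M + 1) + M) mod 4 = (if even j then 1 else 3)"
proof (cases "even j")
  case True
  then obtain l where "j = 2 * l" by blast
  then have "j * (M + 1) + M = 1 + 4 * (l * (2 * h + 1) + h)" by (simp add: M_def algebra_simps)
  then show ?thesis using True by (simp only: mod_mult_self2) simp
next
  case False
  then obtain l where "j = 2 * l + 1" by (rule oddE)
  then have "j * (M + 1) + M = 3 + 4 * (l * (2 * h + 1) + 2 * h)" by (simp add: M_def algebra_simps)
  then show ?thesis using False by (simp only: mod_mult_self2) simp
qed

text \<open>The reflection of \<open>y\<close> to \<open>2 - y\<close> fixes both odd residues
  modulo 4; this is the effect of reversing the direction of a row.\<close>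

lemma add_mod_4_eq_2:
  fixes n y K :: nat
  assumes "n + y = 4 * K + 2"
  shows "(odd n \<longleftrightarrow> odd y) \<and> (odd y \<longrightarrow> y mod 4 = n mod 4)"
proof
  have "even (n + y)" using assms by simp
  then show eq: "odd n \<longleftrightarrow> odd y" by simp
  show "odd y \<longrightarrow> y mod 4 = n mod 4"
  proof
    assume "odd y"
    then obtain u v where "y = 2 * u + 1" "n = 2 * v + 1" using eq by (metis oddE)
    then show "y mod 4 = n mod 4" using assms by presburger
  qed
qed

text \<open>Two rows with their turns take \<open>2 * (M + 1) = 8 * h + 4\<close> blocks, a multiple
  of 4, and a downward row has residue \<open>2 - (x - 1)\<close>. So odd residues agree in all
  rows; even ones may differ, but they carry no demand.\<close>

lemma pos_mod_4:
  assumes "1 \<le> x" "x \<le> M"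
  shows "odd (pos i x) \<longleftrightarrow> odd (x - 1)" "odd (x - 1) \<Longrightarrow> (x - 1) mod 4 = pos i x mod 4"
proof -
  have "(odd (pos i x) \<longleftrightarrow> odd (x - 1)) \<and> (odd (x - 1) \<longrightarrow> (x - 1) mod 4 = pos i x mod 4)"
  proof (cases "even i")
    case True
    then obtain l where "i = 2 * l" by blast
    then have "pos i x = 4 * (l * (2 * h + 1)) + (x - 1)" by (simp add: pos_def M_def algebra_simps)
    then show ?thesis by (simp only: mod_mult_self4) simp
  next
    case False
    then obtain l where "i = 2 * l + 1" by (rule oddE)
    then have "pos i x + (x - 1) = 4 * (l * (2 * h + 1) + 2 * h) + 2"
      using assms by (simp add: pos_def M_def algebra_simps)
    then show ?thesis by (rule add_mod_4_eq_2)
  qed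
  then show "odd (pos i x) \<longleftrightarrow> odd (x - 1)" "odd (x - 1) \<Longrightarrow> (x - 1) mod 4 = pos i x mod 4"
    by auto
qed

lemma type_of_odd:
  assumes "C \<in> cliques X E 3" "z \<in> C" "odd (type_of z)"
  shows "type_of z mod 4 = blk C mod 4"
  using tri_block_blk[OF assms(1)]
proof cases
  case (row i x p w)
  then have "z = U x" using assms(2,3) by auto
  then show ?thesis unfolding row(2) using assms(3) pos_mod_4(2)[OF row(4,5)] by simp
next
  case (turn_V j i)
  then have "z = TU j" using assms(2,3) by auto
  then show ?thesis unfolding turn_V(2) turn_mod_4 by simp
next
  case (turn_SV j i)
  then have "z = TU j" using assms(2,3) by auto
  then show ?thesis unfolding turn_SV(2) turn_mod_4 by simp
qed

lemma odd_blk: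
  assumes "C \<in> cliques X E 3" "odd (blk C)"
  shows "\<exists>z\<in>C. odd (type_of z)"
  using tri_block_blk[OF assms(1)]
proof cases
  case (row i x p w)
  then have "odd (type_of (U x))" using assms(2) pos_mod_4(1)[of x i] by simp
  then show ?thesis unfolding row(1) by blast
next
  case (turn_V j i)
  have "odd (type_of (TU j))" by simp
  then show ?thesis unfolding turn_V(1) by blast
next
  case (turn_SV j i)
  have "odd (type_of (TU j))" by simp
  then show ?thesis unfolding turn_SV(1) by blast
qed

section \<open>A walk through all rows\<close>

abbreviation conn :: "vertex set \<Rightarrow> vertex set \<Rightarrow> bool" where
  "conn C D \<equiv> (C, D) \<in> (jumps (cliques X E 3))\<^sup>*"

lemma conn_swap:
  assumes "insert u K \<in> cliques X E 3" "insert v K \<in> cliques X E 3"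
  shows "conn (insert u K) (insert v K)"
proof (cases "insert u K = insert v K")
  case False
  have fin: "finite K" and c: "card (insert u K) = 3" "card (insert v K) = 3"
    using assms by (simp_all add: cliques_def)
  have "u \<notin> K"
  proof
    assume "u \<in> K"
    then have "card K = 3" using c(1) by (simp add: insert_absorb)
    then have "v \<in> K" using c(2) fin by (metis card_insert_disjoint n_not_Suc_n)
    then show False using False \<open>u \<in> K\<close> by (simp add: insert_absorb)
  qed
  moreover have "v \<notin> K"
  proof
    assume "v \<in> K"
    then have "card K = 3" using c(2) by (simp add: insert_absorb)
    then show False using c(1) fin \<open>u \<notin> K\<close> by simp
  qed
  ultimately have "insert u K \<inter> insert v K = K" "card K + 1 = 3" using False c(1) fin by auto
  then have "(insert u K, insert v K) \<in> jumps (cliques X E 3)"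
    using assms c(1) by (simp add: jumps_def)
  then show ?thesis by blast
qed simp

lemma conn_swap2:
  assumes "{u, v, w} \<in> cliques X E 3" "{u, v', w} \<in> cliques X E 3"
  shows "conn {u, v, w} {u, v', w}"
  using conn_swap[of v "{u, w}" v'] assms by (simp add: insert_commute)

lemma conn_swap3:
  assumes "{u, v, w} \<in> cliques X E 3" "{u, v, w'} \<in> cliques X E 3"
  shows "conn {u, v, w} {u, v, w'}"
  using conn_swap[of w "{u, v}" w'] assms by (simp add: insert_commute)

text \<open>The case \<open>y = x\<close> is a regular triangle of row \<open>i\<close>; the case
  \<open>y = x - 1\<close> has \<open>U\<close> already advanced and \<open>V\<close>,
  \<open>W\<close> still behind.\<close>

definition strip :: "nat \<Rightarrow> nat \<Rightarrow> nat \<Rightarrow> vertex set" where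
  "strip i x y = {U x, V (y + a i), W (y + 2 * a i)}"

lemma row_tri:
  assumes i: "i \<le> 2 * q" and x: "1 \<le> x" "x \<le> M"
    and p: "p = x + a i \<or> Suc p = x + a i"
    and w: "w = p + a i \<or> Suc w = p + a i" "w = x + 2 * a i \<or> Suc w = x + 2 * a i"
  shows "{U x, V p, W w} \<in> cliques X E 3"
proof (rule triI)
  show "U x \<in> X" "V p \<in> X" "W w \<in> X"
    using x p w a_less[OF i] by (auto simp: X_def)
  show "arc (U x) (V p)" "arc (U x) (W w)" "arc (V p) (W w)" using i p w by auto
qed simp_all

lemma strip_tri:
  assumes "i \<le> 2 * q" "1 \<le> x" "x \<le> M" "x = y \<or> x = Suc y"
  shows "strip i x y \<in> cliques X E 3"
  unfolding strip_def using assms by (intro row_tri) auto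

lemma strip_conn:
  assumes i: "i \<le> 2 * q" and x: "1 \<le> x" "x \<le> M"
  shows "conn (strip i x (x - 1)) (strip i x x)"
proof -
  \<comment> \<open>\<open>V\<close> advances before \<open>W\<close>: the other order would need
    \<open>w = p + a i + 1\<close>, which is no edge.\<close>
  let ?D = "{U x, V (x + a i), W (x - 1 + 2 * a i)}"
  have D: "?D \<in> cliques X E 3" using assms by (intro row_tri) auto
  have "conn (strip i x (x - 1)) ?D" unfolding strip_def
    by (rule conn_swap2[OF _ D]) (use strip_tri[OF i x, of "x - 1"] x in \<open>simp add: strip_def\<close>)
  also have "conn ?D (strip i x x)" unfolding strip_def
    by (rule conn_swap3[OF D]) (use strip_tri[OF i x, of x] in \<open>simp add: strip_def\<close>)
  finally show ?thesis .
qed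

lemma row_conn:
  assumes i: "i \<le> 2 * q"
  shows "1 \<le> x \<Longrightarrow> x \<le> M \<Longrightarrow> conn (strip i 1 1) (strip i x x)"
proof (induction x rule: dec_induct)
  case (step x)
  have "conn (strip i 1 1) (strip i x x)" using step by simp
  also have "conn (strip i x x) (strip i (Suc x) x)"
    using strip_tri[OF i, of x x] strip_tri[OF i, of "Suc x" x] step
    unfolding strip_def by (intro conn_swap) auto
  also have "conn (strip i (Suc x) x) (strip i (Suc x) (Suc x))"
    using strip_conn[OF i, of "Suc x"] step by simp
  finally show ?case .
qed simp

text \<open>Each row is compared with the turn starting from \<open>strip i 1 1\<close>, whatever
  its direction of traversal. The detour is harmless, since only reachability is claimed.\<close>

lemma turn_conn:
  assumes j: "j < 2 * q"
  shows "conn (strip j 1 1) (strip (Suc j) 1 1)"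
proof -
  let ?e = "turn_end j"
  \<comment> \<open>The last \<open>U\<close> vertex of the row: \<open>turn_end j\<close> itself if
    that is \<open>M\<close>, and its successor if it is 0, because \<open>U 0\<close> is not in
    \<open>X\<close>.\<close>
  define f where "f = (if even j then M else 1)"
  have f: "1 \<le> f" "f \<le> M" "f = ?e \<or> f = Suc ?e" by (auto simp: f_def turn_end_def M_def)
  have e: "?e \<le> M" by (simp add: turn_end_def)
  let ?A = "\<lambda>i. {TU j, V (?e + a i), W (?e + 2 * a i)}" and ?B = "\<lambda>i. {TU j, SV j, W (?e + 2 * a i)}"
  have half: "conn (strip i 1 1) (?B i)" and B: "?B i \<in> cliques X E 3" if i: "i = j \<or> i = Suc j" for i
  proof -
    have le: "i \<le> 2 * q" using i j by auto
    have mem: "TU j \<in> X" "SV j \<in> X" "V (?e + a i) \<in> X" "W (?e + 2 * a i) \<in> X"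
      using j e a_less[OF le] by (auto simp: X_def)
    have A: "?A i \<in> cliques X E 3" using mem i le by (intro triI) auto
    show B: "?B i \<in> cliques X E 3" using mem i le by (intro triI) auto
    have F: "strip i f ?e \<in> cliques X E 3" using le f by (rule strip_tri)
    have "conn (strip i 1 1) (strip i f f)" using row_conn[OF le] f by simp
    also have "conn (strip i f f) (strip i f ?e)"
      using strip_conn[OF le f(1,2)] f(3) jumps_rtrancl_sym by auto
    also have "conn (strip i f ?e) (?A i)"
      using F A unfolding strip_def by (rule conn_swap)
    also have "conn (?A i) (?B i)" using A B by (rule conn_swap2)
    finally show "conn (strip i 1 1) (?B i)" .
  qed
  have "conn (strip j 1 1) (?B j)" using half by simp
  also have "conn (?B j) (?B (Suc j))" by (rule conn_swap3) (use B in auto)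
  also have "conn (?B (Suc j)) (strip (Suc j) 1 1)"
    by (rule jumps_rtrancl_sym, rule half) simp
  finally show ?thesis .
qed

lemma rows_conn: "i \<le> 2 * q \<Longrightarrow> conn (strip 0 1 1) (strip i 1 1)"
proof (induction i)
  case (Suc i)
  then have "conn (strip 0 1 1) (strip i 1 1)" by simp
  also have "conn (strip i 1 1) (strip (Suc i) 1 1)" using Suc.prems by (intro turn_conn) simp
  finally show ?case .
qed simp

text \<open>With \<open>2 * q + 1\<close> rows the last one runs upwards. It ends at a block
  divisible by 4, as the gadget requires, where the lower levels finish a forward traversal.\<close>

lemma gadget_rows:
  "gadget X E type_of (strip 0 1 1) (strip (2 * q) M M) blk (2 * q * (M + 1) + (M - 1))"
proof -
  have M: "1 \<le> M" by (simp add: M_def)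
  have block: "tri_block (strip i x x) (pos i x)" if "i \<le> 2 * q" "1 \<le> x" "x \<le> M" for i x
    unfolding strip_def by (rule row) (use that in auto)
  have S: "strip 0 1 1 \<in> cliques X E 3" using M by (intro strip_tri) auto
  have T: "strip (2 * q) M M \<in> cliques X E 3" using M by (intro strip_tri) auto
  have "conn (strip 0 1 1) (strip (2 * q) 1 1)" by (intro rows_conn) simp
  also have "conn (strip (2 * q) 1 1) (strip (2 * q) M M)" using M by (intro row_conn) auto
  finally have ST: "conn (strip 0 1 1) (strip (2 * q) M M)" .
  have blk_S: "blk (strip 0 1 1) = 0" using blk_eq[OF S block[of 0 1]] M by (simp add: pos_def)
  have blk_T: "blk (strip (2 * q) M M) = 2 * q * (M + 1) + (M - 1)"
    using blk_eq[OF T block[of "2 * q" M]] M by (simp add: pos_def)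
  have "2 * q * (M + 1) + (M - 1) = 4 * (q * (2 * h + 1) + h)" by (simp add: M_def algebra_simps)
  then have P: "4 dvd 2 * q * (M + 1) + (M - 1)" by (rule dvdI)
  have X: "finite X" by (simp add: X_def)
  have E: "\<And>u v. E u v \<Longrightarrow> E v u" by (auto simp: E_def)
  show ?thesis
  proof (rule gadget.intro)
    show "E v u" if "E u v" for u v using that by (rule E)
    show "blk s' \<le> blk s + 1" if "(s, s') \<in> jumps (cliques X E 3)" for s s'
      using that by (rule blk_jump)
    show "type_of z mod 4 = blk s mod 4" if "s \<in> cliques X E 3" "z \<in> s" "odd (type_of z)" for s z
      using that by (rule type_of_odd)
    show "\<exists>z\<in>s. odd (type_of z)" if "s \<in> cliques X E 3" "odd (blk s)" for s
      using that by (rule odd_blk)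
  qed (rule X no4 S ST blk_S blk_T P)+
qed

lemma card_X_le: "card X \<le> 3 * M + 12 * N + 4 * q"
proof -
  have un: "card (A \<union> B) \<le> x + y" if "card A \<le> x" "card B \<le> y" for A B :: "vertex set" and x y
    using card_Un_le[of A B] that by linarith
  have "card X \<le> card {1..M} + card {..<M + 4 * N} + card {..<M + 8 * N} + card {..<2 * q}
      + card {..<2 * q}"
    unfolding X_def by (intro un card_image_le) auto
  then show ?thesis by simp
qed

end

section \<open>Progression-free sets\<close>

lemma digit_sums_inj:
  fixes f g :: "nat \<Rightarrow> nat"
  assumes "(\<Sum>i<d. f i * B ^ i) = (\<Sum>i<d. g i * B ^ i)"
    and "\<And>i. i < d \<Longrightarrow> f i < B" "\<And>i. i < d \<Longrightarrow> g i < B"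
  shows "\<forall>i<d. f i = g i"
  using assms
proof (induction d arbitrary: f g)
  case (Suc d)
  have *: "(\<Sum>i<Suc d. h i * B ^ i) = h 0 + B * (\<Sum>i<d. h (Suc i) * B ^ i)" for h :: "nat \<Rightarrow> nat"
    by (subst sum.lessThan_Suc_shift) (simp add: sum_distrib_left mult.left_commute)
  have eq: "f 0 + B * (\<Sum>i<d. f (Suc i) * B ^ i) = g 0 + B * (\<Sum>i<d. g (Suc i) * B ^ i)"
    using Suc.prems(1) unfolding * .
  have lt: "f 0 < B" "g 0 < B" using Suc.prems by auto
  have "f 0 = g 0" using arg_cong[OF eq, of "\<lambda>x. x mod B"] lt by simp
  moreover from this have "(\<Sum>i<d. f (Suc i) * B ^ i) = (\<Sum>i<d. g (Suc i) * B ^ i)"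
    using eq lt by simp
  then have "\<forall>i<d. f (Suc i) = g (Suc i)" using Suc.prems(2,3) by (intro Suc.IH) auto
  ultimately show ?case by (auto simp: less_Suc_eq_0_disj)
qed simp

lemma digit_sum_less:
  fixes f :: "nat \<Rightarrow> nat"
  assumes "\<And>i. i < d \<Longrightarrow> f i < B"
  shows "(\<Sum>i<d. f i * B ^ i) < B ^ d"
  using assms
proof (induction d)
  case (Suc d)
  have "f d * B ^ d \<le> (B - 1) * B ^ d" using Suc.prems[of d] by (intro mult_right_mono) auto
  moreover have "(B - 1) * B ^ d + B ^ d = B ^ Suc d" using Suc.prems[of d] by (cases B) auto
  moreover have "(\<Sum>i<d. f i * B ^ i) < B ^ d" using Suc.prems by (intro Suc.IH) simp
  ultimately show ?case unfolding sum.lessThan_Suc by linarith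
qed simp

definition progression_free :: "nat set \<Rightarrow> bool" where
  "progression_free A \<longleftrightarrow> (\<forall>x\<in>A. \<forall>y\<in>A. \<forall>z\<in>A. x + y = 2 * z \<longrightarrow> x = y)"

text \<open>
  Behrend's construction: by the parallelogram law a sphere contains no three-term progression,
  and reading digit vectors in base \<open>2 b\<close> transports this to numbers, as digits below \<open>b\<close> add
  without carry.
\<close>

lemma behrend_sphere:
  fixes b d :: nat
  assumes b: "0 < b" and d: "0 < d"
  obtains A where "A \<subseteq> {..<(2 * b) ^ d}" "progression_free A" "b ^ d \<le> card A * (d * b ^ 2)"
proof -
  define D where "D = {..<d} \<rightarrow>\<^sub>E {..<b}"
  define nrm where "nrm f = (\<Sum>i<d. f i ^ 2)" for f :: "nat \<Rightarrow> nat"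
  define enc where "enc f = (\<Sum>i<d. f i * (2 * b) ^ i)" for f :: "nat \<Rightarrow> nat"
  have fin: "finite D" and cD: "card D = b ^ d" by (simp_all add: D_def finite_PiE card_PiE)
  have dig: "f i < b" if "f \<in> D" "i < d" for f i using that by (auto simp: D_def PiE_def Pi_def)
  have inj: "inj_on enc D"
  proof (rule inj_onI)
    fix f g assume fg: "f \<in> D" "g \<in> D" "enc f = enc g"
    then have "\<forall>i<d. f i = g i" unfolding enc_def
      by (intro digit_sums_inj[where B = "2 * b"]) (use dig in \<open>force+\<close>)
    then show "f = g" using fg(1,2) by (auto simp: D_def intro: PiE_ext)
  qed
  have nrm_lt: "nrm f < d * b ^ 2" if "f \<in> D" for f
  proof -
    have "nrm f < (\<Sum>i<d. b ^ 2)" unfolding nrm_def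
      using dig[OF that] d by (intro sum_strict_mono) (auto simp: power_strict_mono)
    then show ?thesis by simp
  qed
  \<comment> \<open>Pigeonhole over the possible squared norms.\<close>
  have "\<exists>R<d * b ^ 2. b ^ d \<le> card {f \<in> D. nrm f = R} * (d * b ^ 2)"
  proof (rule ccontr)
    assume "\<not> ?thesis"
    then have lt: "card {f \<in> D. nrm f = R} * (d * b ^ 2) < b ^ d" if "R < d * b ^ 2" for R
      using that by (meson not_le)
    have "D = (\<Union>R<d * b ^ 2. {f \<in> D. nrm f = R})" using nrm_lt by auto
    then have "card D = card (\<Union>R<d * b ^ 2. {f \<in> D. nrm f = R})" by simp
    also have "\<dots> = (\<Sum>R<d * b ^ 2. card {f \<in> D. nrm f = R})"
      using fin by (intro card_UN_disjoint) auto
    finally have "b ^ d * (d * b ^ 2) = (\<Sum>R<d * b ^ 2. card {f \<in> D. nrm f = R} * (d * b ^ 2))"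
      by (simp add: cD sum_distrib_right)
    also have "\<dots> < (\<Sum>R<d * b ^ 2. b ^ d)"
    proof (intro sum_strict_mono)
      show "{..<d * b ^ 2} \<noteq> {}" using b d by (metis lessThan_empty_iff mult_eq_0_iff not_gr_zero power_not_zero zero_less_iff_neq_zero)
    qed (use lt in auto)
    finally show False by simp
  qed
  then obtain R where R: "b ^ d \<le> card {f \<in> D. nrm f = R} * (d * b ^ 2)" by blast
  define F where "F = {f \<in> D. nrm f = R}"
  have "progression_free (enc ` F)" unfolding progression_free_def
  proof (intro ballI impI)
    fix x y z assume "x \<in> enc ` F" "y \<in> enc ` F" "z \<in> enc ` F" and xyz: "x + y = 2 * z"
    then obtain f g h where F: "f \<in> F" "g \<in> F" "h \<in> F" and x: "x = enc f" "y = enc g" "z = enc h"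
      by blast
    have D: "f \<in> D" "g \<in> D" "h \<in> D" using F by (auto simp: F_def)
    have "(\<Sum>i<d. (f i + g i) * (2 * b) ^ i) = (\<Sum>i<d. (2 * h i) * (2 * b) ^ i)"
      using xyz unfolding x enc_def
      by (simp add: sum.distrib[symmetric] sum_distrib_left algebra_simps)
    then have mid: "\<forall>i<d. f i + g i = 2 * h i"
      by (rule digit_sums_inj) (use dig[OF D(1)] dig[OF D(2)] dig[OF D(3)] in \<open>fastforce+\<close>)
    have "(\<Sum>i<d. (int (f i) - int (g i)) ^ 2) =
        (\<Sum>i<d. 2 * int (f i) ^ 2 + 2 * int (g i) ^ 2 - 4 * int (h i) ^ 2)"
    proof (rule sum.cong)
      fix i assume "i \<in> {..<d}"
      then have "2 * int (h i) = int (f i) + int (g i)" using mid by (metis lessThan_iff of_nat_add of_nat_mult of_nat_numeral)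
      then have "(2 * int (h i)) ^ 2 = (int (f i) + int (g i)) ^ 2" by simp
      then show "(int (f i) - int (g i)) ^ 2 = 2 * int (f i) ^ 2 + 2 * int (g i) ^ 2 - 4 * int (h i) ^ 2"
        by (simp add: power2_eq_square algebra_simps)
    qed simp
    also have "\<dots> = 2 * int (nrm f) + 2 * int (nrm g) - 4 * int (nrm h)"
      by (simp add: nrm_def sum.distrib sum_subtractf sum_distrib_left)
    also have "\<dots> = 0" using F by (simp add: F_def)
    finally have "\<forall>i\<in>{..<d}. (int (f i) - int (g i)) ^ 2 = 0"
      by (subst (asm) sum_nonneg_eq_0_iff) auto
    then show "x = y" by (simp add: x enc_def)
  qed
  moreover have "card (enc ` F) = card F"
    using inj by (intro card_image) (auto intro: inj_on_subset simp: F_def)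
  moreover have "enc ` F \<subseteq> {..<(2 * b) ^ d}"
    using dig unfolding enc_def F_def by (force intro!: digit_sum_less)
  ultimately show ?thesis using that[of "enc ` F"] R by (simp add: F_def)
qed

text \<open>Digits lie below \<open>b = 2 ^ (d - 1)\<close> in base \<open>2 ^ d\<close>. Halving
  the digit range costs a factor \<open>2 ^ d\<close>, and selecting a sphere at most
  \<open>d * b ^ 2 \<le> 2 ^ (3 * d)\<close>. The assumption keeps the subtraction in the exponent
  from being truncated.\<close>

lemma behrend:
  assumes d: "4 \<le> d"
  obtains A where "A \<subseteq> {..<2 ^ (d\<^sup>2)}" "progression_free A" "2 ^ (d\<^sup>2 - 4 * d) \<le> card A"
proof -
  obtain e where e: "d = Suc e" using d by (cases d) auto
  have "(0::nat) < 2 ^ e" "0 < d" using d by auto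
  from behrend_sphere[OF this] obtain A where A: "A \<subseteq> {..<(2 * 2 ^ e) ^ d}" "progression_free A"
    "(2 ^ e) ^ d \<le> card A * (d * (2 ^ e) ^ 2)" by blast
  have "(2 * 2 ^ e) ^ d = (2::nat) ^ (d\<^sup>2)"
    by (simp add: e power2_eq_square flip: power_mult power_Suc)
  moreover have "2 ^ (d\<^sup>2 - 4 * d) \<le> card A"
  proof -
    have "d\<^sup>2 - 4 * d + 3 * d = e * d"
    proof -
      have "4 * d \<le> d\<^sup>2" using d by (simp add: power2_eq_square)
      moreover have "d\<^sup>2 = e * d + d" by (simp add: e power2_eq_square)
      ultimately show ?thesis by simp
    qed
    then have "2 ^ (d\<^sup>2 - 4 * d) * 2 ^ (3 * d) = ((2::nat) ^ e) ^ d"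
      by (simp add: power_add[symmetric] flip: power_mult)
    also have "\<dots> \<le> card A * (d * (2 ^ e) ^ 2)" by (rule A(3))
    also have "d * (2 ^ e) ^ 2 \<le> 2 ^ d * 2 ^ (2 * d)"
    proof (intro mult_mono)
      show "d \<le> 2 ^ d" by (simp add: less_imp_le)
      show "(2 ^ e) ^ 2 \<le> (2::nat) ^ (2 * d)" by (simp add: e mult.commute flip: power_mult)
    qed auto
    also have "(2::nat) ^ d * 2 ^ (2 * d) = 2 ^ (3 * d)" by (simp flip: power_add)
    finally show ?thesis by simp
  qed
  ultimately show ?thesis using A that by simp
qed

section \<open>The lower bound\<close>

text \<open>Since \<open>M = N + 1\<close> and \<open>4 * q \<le> N\<close>,
  \<open>card_X_le\<close> gives at most \<open>20 * N\<close> vertices per level. The walk has at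
  least \<open>2 * q * N\<close> steps between blocks, and half of this is the base of the
  power.\<close>

lemma max_config_diameter_ge_pow:
  assumes d: "5 \<le> d" and m: "m \<noteq> 0" and n: "m * (20 * 2 ^ d\<^sup>2) + j \<le> n"
  shows "ereal (2 ^ (m * (2 * d\<^sup>2 - 4 * d - 2))) \<le> max_config_diameter n (3 * m + j)"
proof -
  \<comment> \<open>Behrend's set has at least \<open>4 * q\<close> elements, enough for the
    \<open>2 * q + 1\<close> rows.\<close>
  define N q :: nat where "N = 2 ^ d\<^sup>2" and "q = 2 ^ (d\<^sup>2 - 4 * d - 2)"
  have d2: "4 * d + 2 \<le> d\<^sup>2"
  proof -
    have "5 * d \<le> d\<^sup>2" using d by (simp add: power2_eq_square)
    then show ?thesis using d by simp
  qed
  have "4 \<le> d" using d by simp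
  then obtain A where A: "A \<subseteq> {..<2 ^ d\<^sup>2}" "progression_free A" "2 ^ (d\<^sup>2 - 4 * d) \<le> card A"
    by (rule behrend)
  have "d\<^sup>2 - 4 * d = (d\<^sup>2 - 4 * d - 2) + 2" using d2 by simp
  then have "2 ^ (d\<^sup>2 - 4 * d) = q * 2 ^ 2" unfolding q_def by (metis power_add)
  moreover have "1 \<le> q" by (simp add: q_def)
  ultimately have "card {..2 * q} \<le> card A" using A(3) by simp
  moreover have "finite A" using A(1) finite_subset by blast
  ultimately obtain f where f: "f ` {..2 * q} \<subseteq> A" "inj_on f {..2 * q}"
    by (metis card_le_inj finite_atMost)
  interpret rows "\<lambda>i. 4 * f i" "2 ^ (d\<^sup>2 - 2)" q N
  proof
    show "4 * f i < 4 * N" if "i \<le> 2 * q" for i using f(1) A(1) that by (auto simp: N_def)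
    show "i = l \<and> j = l"
      if le: "i \<le> 2 * q" "j \<le> 2 * q" "l \<le> 2 * q" and eq: "4 * f i + 4 * f j = 2 * (4 * f l)" for i j l
    proof -
      have "f i \<in> A" "f j \<in> A" "f l \<in> A" "f i + f j = 2 * f l" using f(1) le eq by auto
      then have "f i = f j" "f l = f j" using A(2) unfolding progression_free_def by force+
      then show ?thesis using f(2) le by (auto simp: inj_on_def)
    qed
  qed simp
  interpret gadget X E type_of "strip 0 1 1" "strip (2 * q) M M" blk "2 * q * (M + 1) + (M - 1)"
    by (rule gadget_rows)
  have "d\<^sup>2 = 2 + (d\<^sup>2 - 2)" using d2 by simp
  then have "N = 2 ^ 2 * 2 ^ (d\<^sup>2 - 2)" unfolding N_def by (metis power_add)
  then have M: "M = N + 1" by (simp add: M_def)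
  have "4 * q \<le> N"
  proof -
    have "4 * q = 2 ^ (2 + (d\<^sup>2 - 4 * d - 2))" by (simp add: q_def power_add)
    also have "\<dots> \<le> N" unfolding N_def using d2 by (intro power_increasing) auto
    finally show ?thesis .
  qed
  moreover have "1 \<le> N" by (simp add: N_def)
  ultimately have "card X \<le> 20 * N" using card_X_le M by simp
  then have "m * card X \<le> m * (20 * N)" by (rule mult_le_mono2)
  then have "m * card X + j \<le> n" using n unfolding N_def by linarith
  from max_config_diameter_ge[OF m this]
  have "ereal ((real (2 * q * (M + 1) + (M - 1)) / 2) ^ m) \<le> max_config_diameter n (3 * m + j)" .
  moreover have "2 ^ (m * (2 * d\<^sup>2 - 4 * d - 2)) \<le> (real (2 * q * (M + 1) + (M - 1)) / 2) ^ m"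
  proof -
    have "2 * d\<^sup>2 - 4 * d - 2 = (d\<^sup>2 - 4 * d - 2) + d\<^sup>2" using d2 by simp
    then have "(2::real) ^ (2 * d\<^sup>2 - 4 * d - 2) = real (q * N)"
      unfolding q_def N_def by (simp add: power_add)
    also have "\<dots> \<le> real (2 * q * (M + 1) + (M - 1)) / 2"
    proof -
      have "2 * (q * N) \<le> 2 * q * (M + 1) + (M - 1)" by (simp add: M)
      then have "real (2 * (q * N)) \<le> real (2 * q * (M + 1) + (M - 1))" by (rule of_nat_mono)
      then show ?thesis by simp
    qed
    finally have "((2::real) ^ (2 * d\<^sup>2 - 4 * d - 2)) ^ m \<le> (real (2 * q * (M + 1) + (M - 1)) / 2) ^ m"
      by (intro power_mono) auto
    then show ?thesis by (simp add: mult.commute flip: power_mult)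
  qed
  ultimately show ?thesis by (meson ereal_less_eq(3) order_trans)
qed

text \<open>One token moves on \<open>n - k + 1 \<ge> 2\<close> vertices without edges in
  \<open>?E\<close>, beside \<open>k - 1\<close> frozen ones. This settles the exponent 0, where the
  claimed bound is at most 1.\<close>

lemma max_config_diameter_ge_1:
  assumes "k \<ge> 1" "k < n"
  shows "1 \<le> max_config_diameter n k"
proof -
  let ?X = "{..n - k}" and ?E = "\<lambda>_ _ :: nat. False"
  have sing: "C \<in> cliques ?X ?E 1 \<longleftrightarrow> (\<exists>x\<le>n - k. C = {x})" for C
    by (auto simp: cliques_def card_1_singleton_iff)
  have "ereal (of_int ((if 0 \<in> {1::nat} then 0 else 1) - (if 0 \<in> {0::nat} then 0 else 1)))
      \<le> max_config_diameter n (1 + (k - 1))"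
  proof (rule clique_potential_le_max_config_diameter[where E = ?E and X = ?X
        and pot = "\<lambda>C. if 0 \<in> C then 0 else 1"])
    show "cliques ?X ?E (Suc 1) = {}"
      by (auto simp: cliques_def card_Suc_eq)
    show "{0} \<in> cliques ?X ?E 1" unfolding sing by simp
    have "({0}, {1}) \<in> jumps (cliques ?X ?E 1)" using assms unfolding jumps_def sing by simp
    then show "({0}, {1}) \<in> (jumps (cliques ?X ?E 1))\<^sup>*" by blast
    show "card ?X + (k - 1) \<le> n" "2 \<le> 1 + (k - 1) \<or> card ?X + (k - 1) = n"
      using assms by auto
  qed auto
  then show ?thesis using assms(1) by (simp add: one_ereal_def)
qed

theorem mainTheorem3:
  fixes k :: nat
  assumes "k \<ge> 1"
  shows "\<exists>c C :: real. c > 0 \<and> C > 0 \<and>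
           (\<forall>\<^sub>F n :: nat in sequentially.
              max_config_diameter n k
                \<ge> ereal (c * (real n ^ (2 * (k div 3)) / exp (C * sqrt (ln (real n))))))"
proof (cases "k div 3 = 0")
  case True
  have "ereal (1 * (real n ^ (2 * (k div 3)) / exp (1 * sqrt (ln (real n))))) \<le> max_config_diameter n k"
    if "n > k" for n
  proof -
    have "0 \<le> sqrt (ln (real n))" using that by simp
    then have "1 * (real n ^ (2 * (k div 3)) / exp (1 * sqrt (ln (real n)))) \<le> 1"
      unfolding True by (simp add: divide_le_eq)
    then have "ereal (1 * (real n ^ (2 * (k div 3)) / exp (1 * sqrt (ln (real n))))) \<le> 1"
      by (simp add: one_ereal_def)
    also have "1 \<le> max_config_diameter n k" using assms that by (rule max_config_diameter_ge_1)
    finally show ?thesis .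
  qed
  then have "\<forall>\<^sub>F n in sequentially.
      ereal (1 * (real n ^ (2 * (k div 3)) / exp (1 * sqrt (ln (real n))))) \<le> max_config_diameter n k"
    using eventually_gt_at_top[of k] by (rule eventually_mono[rotated])
  then show ?thesis by (intro exI[of _ 1]) auto
next
  case False
  define m j where "m = k div 3" and "j = k mod 3"
  have k: "3 * m + j = k" and j: "j \<le> 2" and m: "m \<noteq> 0" using False by (auto simp: m_def j_def)
  \<comment> \<open>\<open>20 * m\<close> pays for the \<open>m\<close> levels, and 2 for the
    leftover tokens.\<close>
  define K where "K = 20 * m + 2"
  \<comment> \<open>The size of \<open>n\<close> gives exponent
    \<open>2 * m * (d + 1)\<^sup>2\<close>, the construction
    \<open>m * (2 * d\<^sup>2 - 4 * d - 2)\<close>. Of the difference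
    \<open>4 * m + 8 * m * d\<close> the first summand goes into \<open>c\<close>, the second into
    \<open>C\<close>.\<close>
  define c C where "c = 1 / (real K ^ (2 * m) * 2 ^ (4 * m))" and "C = 8 * real m"
  have bound: "ereal (c * (real n ^ (2 * m) / exp (C * sqrt (ln (real n))))) \<le> max_config_diameter n k"
    if n: "K * 2 ^ 25 \<le> n" for n
  proof -
    \<comment> \<open>Minimality places \<open>n\<close> between \<open>K * 2 ^ d\<^sup>2\<close>
      and \<open>K * 2 ^ (d + 1)\<^sup>2\<close>; the threshold exponent
      \<open>25 = 5\<^sup>2\<close> forces \<open>5 \<le> d\<close>.\<close>
    define d where "d = (LEAST d. n < K * 2 ^ (d + 1)\<^sup>2)"
    have "n < 2 ^ n" by simp
    also have "(2::nat) ^ n \<le> 2 ^ (n + 1)\<^sup>2" by (intro power_increasing) (auto simp: power2_eq_square)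
    also have "\<dots> \<le> K * 2 ^ (n + 1)\<^sup>2" by (simp add: K_def)
    finally have upper: "n < K * 2 ^ (d + 1)\<^sup>2" unfolding d_def by (rule LeastI)
    have d5: "5 \<le> d"
    proof (rule ccontr)
      assume "\<not> 5 \<le> d"
      then have "(d + 1)\<^sup>2 \<le> 5\<^sup>2" by (intro power_mono) auto
      then have "K * 2 ^ (d + 1)\<^sup>2 \<le> K * 2 ^ 25" by (intro mult_le_mono2 power_increasing) auto
      then show False using upper n by linarith
    qed
    have lower: "K * 2 ^ d\<^sup>2 \<le> n"
      using not_less_Least[of "d - 1" "\<lambda>d. n < K * 2 ^ (d + 1)\<^sup>2", folded d_def] d5 by simp
    have "m * (20 * 2 ^ d\<^sup>2) + j \<le> K * 2 ^ d\<^sup>2"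
    proof -
      have "2 * 1 \<le> 2 * (2::nat) ^ d\<^sup>2" by (intro mult_le_mono2) simp
      then have "j \<le> 2 * 2 ^ d\<^sup>2" using j by linarith
      then show ?thesis by (simp add: K_def algebra_simps)
    qed
    then have "m * (20 * 2 ^ d\<^sup>2) + j \<le> n" using lower by linarith
    from max_config_diameter_ge_pow[OF d5 m this]
    have "ereal (2 ^ (m * (2 * d\<^sup>2 - 4 * d - 2))) \<le> max_config_diameter n k" by (simp only: k)
    moreover have "c * (real n ^ (2 * m) / exp (C * sqrt (ln (real n)))) \<le> 2 ^ (m * (2 * d\<^sup>2 - 4 * d - 2))"
    proof -
      have "2 ^ d\<^sup>2 \<le> n" using lower by (simp add: K_def)
      then have n2: "(2::real) ^ d\<^sup>2 \<le> real n" by (metis of_nat_le_iff of_nat_numeral of_nat_power)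
      have "real d * ln 2 \<le> sqrt (ln (real n))"
      proof (rule real_le_rsqrt)
        have "(real d * ln 2)\<^sup>2 = (real d)\<^sup>2 * (ln 2 * ln 2)" by (simp add: power2_eq_square)
        also have "\<dots> \<le> (real d)\<^sup>2 * (1 * ln 2)"
          using ln_2_less_1 by (intro mult_left_mono mult_right_mono) auto
        also have "\<dots> = ln (2 ^ d\<^sup>2)" by (simp add: ln_realpow)
        also have "\<dots> \<le> ln (real n)" using n2 by (intro ln_mono) auto
        finally show "(real d * ln 2)\<^sup>2 \<le> ln (real n)" .
      qed
      then have "C * (real d * ln 2) \<le> C * sqrt (ln (real n))"
        by (intro mult_left_mono) (auto simp: C_def)
      then have "exp (C * (real d * ln 2)) \<le> exp (C * sqrt (ln (real n)))" by simp
      moreover have "exp (C * (real d * ln 2)) = 2 ^ (8 * m * d)"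
      proof -
        have "C * (real d * ln 2) = real (8 * m * d) * ln 2" by (simp add: C_def)
        then show ?thesis by (simp only: exp_of_nat_mult) simp
      qed
      ultimately have ex: "2 ^ (8 * m * d) \<le> exp (C * sqrt (ln (real n)))" by simp
      have "real n \<le> real (K * 2 ^ (d + 1)\<^sup>2)" using upper by (intro of_nat_mono) simp
      then have "real n ^ (2 * m) \<le> (real K * 2 ^ (d + 1)\<^sup>2) ^ (2 * m)" by (intro power_mono) auto
      also have "\<dots> = real K ^ (2 * m) * 2 ^ ((d + 1)\<^sup>2 * (2 * m))"
        by (simp add: power_mult_distrib flip: power_mult)
      also have "(d + 1)\<^sup>2 * (2 * m) = m * (2 * d\<^sup>2 - 4 * d - 2) + 4 * m + 8 * m * d"
      proof -
        have "5 * d \<le> d\<^sup>2" using d5 by (simp add: power2_eq_square)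
        then have "2 * d\<^sup>2 = (2 * d\<^sup>2 - 4 * d - 2) + 4 * d + 2" using d5 by simp
        then have "m * (2 * d\<^sup>2) = m * ((2 * d\<^sup>2 - 4 * d - 2) + 4 * d + 2)" by (rule arg_cong)
        then show ?thesis by (simp add: power2_eq_square algebra_simps)
      qed
      finally have "real n ^ (2 * m) \<le>
          real K ^ (2 * m) * 2 ^ (4 * m) * (2 ^ (m * (2 * d\<^sup>2 - 4 * d - 2)) * 2 ^ (8 * m * d))"
        by (simp add: power_add mult_ac)
      also have "\<dots> \<le> real K ^ (2 * m) * 2 ^ (4 * m) *
          (2 ^ (m * (2 * d\<^sup>2 - 4 * d - 2)) * exp (C * sqrt (ln (real n))))"
        using ex by (intro mult_left_mono) auto
      finally have "real n ^ (2 * m) \<le> real K ^ (2 * m) * 2 ^ (4 * m) *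
          (2 ^ (m * (2 * d\<^sup>2 - 4 * d - 2)) * exp (C * sqrt (ln (real n))))" .
      moreover have "0 < real K ^ (2 * m) * 2 ^ (4 * m)" by (simp add: K_def)
      ultimately show ?thesis by (simp add: c_def divide_simps mult_ac)
    qed
    ultimately show ?thesis by (meson ereal_less_eq(3) order_trans)
  qed
  have "0 < c" "0 < C" using m by (simp_all add: c_def C_def K_def)
  moreover have "\<forall>\<^sub>F n in sequentially.
      ereal (c * (real n ^ (2 * m) / exp (C * sqrt (ln (real n))))) \<le> max_config_diameter n k"
    using eventually_ge_at_top[of "K * 2 ^ 25"] by (rule eventually_mono) (rule bound)
  ultimately show ?thesis unfolding m_def by blast
qed

end
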